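(* Let $p,q$ be distinct odd primes, and let $\Gamma_p$ be a constant (depending only on $p$) with the following property: for every odd prime $r>\Gamma_p$ that generates the multiplicative group $\mathbb Z_p^*$, all minors of the $p\times p$ matrix $(\omega^{jk})_{j,k\in\{0,\ldots,p-1\}}$ are non-zero in the finite field $\mathbb F_{r^{p-1}}$, where $\omega$ is a primitive $p$-th root of unity in $\mathbb F_{r^{p-1}}$. If $q$ generates $\mathbb Z_p^*$ and $q>\Gamma_p$, then the Kronecker product $F_p\otimes F_q$ is principally non-singular, i.e., all its principal minors are non-zero.
   Context: $\mathbb Z_n=\{0,1,\ldots,n-1\}$ is the additive cyclic group of order $n$, $\mathbb Z_n^*$ is the multiplicative group modulo $n$, and $\zeta_n=e^{2\pi i/n}$. The Fourier matrix $F_n$ is the $n\times n$ complex matrix with rows and columns indexed by $\mathbb Z_n$ and $(j,k)$-th entry $\zeta_n^{jk}$ (no normalizing factor). For $A\in\mathbb C^{m\times m}$ and $B\in\mathbb C^{n\times n}$, the Kronecker product $A\otimes B$ is the $mn\times mn$ block matrix whose $(i,j)$-th block is $A[i,j]B$. Equivalently, its rows and columns are indexed by pairs in $\mathbb Z_m\times\mathbb Z_n$, and its entry in row $(i,i')$ and column $(j,j')$ is $A[i,j]B[i',j']$. In particular $F_p\otimes F_q$ is the Fourier matrix on $\mathbb Z_p\times\mathbb Z_q$. For a matrix whose rows and columns are indexed by the same finite set, and subsets $\mathcal I,\mathcal J$ of this index set, $A[\mathcal I,\mathcal J]$ is the submatrix with row indices in $\mathcal I$ and column indices in $\mathcal J$.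 A minor is the determinant of $A[\mathcal I,\mathcal J]$ with $|\mathcal I|=|\mathcal J|$. A principal minor is a minor with $\mathcal I=\mathcal J$. "$q$ generates $\mathbb Z_p^*$" means that the residue class of $q$ generates the multiplicative group modulo $p$. $\mathbb F_{r^{k}}$ is the finite field with $r^{k}$ elements. It is a known theorem (Zhang, 2019) that for every odd prime $p$ a constant $\Gamma_p$ with the property stated in the claim exists. The property does not depend on the choice of the primitive $p$-th root of unity $\omega$. *)

theory Defs
  imports
    Complex_Main
    "HOL-Algebra.Generated_Groups"
    "HOL-Number_Theory.Residues"
    "Jordan_Normal_Form.Determinant"
    "Jordan_Normal_Form.DL_Submatrix"
begin

definition fourier_mat :: "nat \<Rightarrow> complex mat" where
  "fourier_mat n = mat n n (\<lambda>(j, k). exp (2 * of_real pi * \<i> / of_nat n) ^ (j * k))"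

text \<open>Block form: the pair of row indices \<open>(i, i')\<close> is encoded as \<open>i * dim_row B + i'\<close>,
  and similarly for columns.\<close>

definition kronecker_prod :: "'a::times mat \<Rightarrow> 'a mat \<Rightarrow> 'a mat" where
  "kronecker_prod A B = mat (dim_row A * dim_row B) (dim_col A * dim_col B)
     (\<lambda>(i, j). A $$ (i div dim_row B, j div dim_col B) * B $$ (i mod dim_row B, j mod dim_col B))"

definition principally_nonsingular :: "'a::comm_ring_1 mat \<Rightarrow> bool" where
  "principally_nonsingular A \<longleftrightarrow> square_mat A \<and>
     (\<forall>I \<subseteq> {..<dim_row A}. det (submatrix A I I) \<noteq> 0)"

definition generates_units_mod :: "nat \<Rightarrow> nat \<Rightarrow> bool" where
  "generates_units_mod p a \<longleftrightarrow>
     int a mod int p \<in> carrier (units_of (residue_ring (int p))) \<and>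
     generate (units_of (residue_ring (int p))) {int a mod int p}
       = carrier (units_of (residue_ring (int p)))"

text \<open>The constant \<^const>\<open>det\<close> needs a type class; the following is the same Leibniz formula
  for matrices over a ring given as a record. It is used for finite fields whose order varies
  inside a formula.\<close>

definition ring_det :: "('a, 'b) ring_scheme \<Rightarrow> 'a mat \<Rightarrow> 'a" where
  "ring_det K A = (if dim_row A = dim_col A
     then \<Oplus>\<^bsub>K\<^esub>\<sigma> \<in> {\<sigma>. \<sigma> permutes {0..<dim_row A}}.
       (let t = (\<Otimes>\<^bsub>K\<^esub>i \<in> {0..<dim_row A}. A $$ (i, \<sigma> i))
        in if evenperm \<sigma> then t else \<ominus>\<^bsub>K\<^esub> t)
     else \<zero>\<^bsub>K\<^esub>)"

definition primitive_root_of_unity :: "('a, 'b) ring_scheme \<Rightarrow> nat \<Rightarrow> 'a \<Rightarrow> bool" where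
  "primitive_root_of_unity K n w \<longleftrightarrow> w \<in> carrier K \<and> w [^]\<^bsub>K\<^esub> n = \<one>\<^bsub>K\<^esub> \<and>
     (\<forall>k::nat. 0 < k \<and> k < n \<longrightarrow> w [^]\<^bsub>K\<^esub> k \<noteq> \<one>\<^bsub>K\<^esub>)"

definition all_minors_nonzero :: "('a, 'b) ring_scheme \<Rightarrow> 'a mat \<Rightarrow> bool" where
  "all_minors_nonzero K A \<longleftrightarrow>
     (\<forall>I J. I \<subseteq> {..<dim_row A} \<and> J \<subseteq> {..<dim_col A} \<and> card I = card J \<longrightarrow>
        ring_det K (submatrix A I J) \<noteq> \<zero>\<^bsub>K\<^esub>)"

text \<open>The field \<open>K\<close> ranges over all models of the finite field with \<open>r ^ (p - 1)\<close> elements whose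
  carrier is a set of natural numbers. Every finite field has such an isomorphic copy, so
  restricting to the type \<^typ>\<open>nat\<close> loses nothing.\<close>

definition minors_bound :: "nat \<Rightarrow> real \<Rightarrow> bool" where
  "minors_bound p \<Gamma> \<longleftrightarrow>
     (\<forall>r. prime r \<and> odd r \<and> real r > \<Gamma> \<and> generates_units_mod p r \<longrightarrow>
       (\<forall>(K :: nat ring) \<omega>. field K \<and> card (carrier K) = r ^ (p - 1) \<and> primitive_root_of_unity K p \<omega> \<longrightarrow>
          all_minors_nonzero K (mat p p (\<lambda>(j, k). \<omega> [^]\<^bsub>K\<^esub> (j * k)))))"

end

theory Submission
  imports Defs "HOL-Algebra.Weak_Morphisms"
begin

text \<open>Suppose a principal minor with index set \<open>I\<close> vanishes, with kernel vector \<open>w\<close>. Let \<open>M\<close> be a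
  maximal ideal of \<open>R = \<int>[\<zeta>\<^sub>p\<^sub>q]\<close> above \<open>q\<close>. Since \<open>q\<close> generates the units modulo \<open>p\<close>, the residue field
  has \<open>q ^ (p - 1)\<close> elements, so the principal minors of \<open>F\<^sub>p\<close> are units modulo \<open>M\<close>, while
  \<open>\<zeta>\<^sub>q\<close> reduces to \<open>1\<close>. Within each block of rows, replace powers of the nodes \<open>\<zeta>\<^sub>q ^ b\<close>
  by their divided differences, which reduce to binomial coefficients. The kernel equations then say
  that binomial moments of the blocks of \<open>w\<close> satisfy linear systems whose determinants are principal
  minors of \<open>F\<^sub>p\<close>; by induction on the order of the moment all entries of \<open>w\<close> lie in \<open>M\<close>
  times the \<open>R\<close>-span of \<open>w\<close>, which contradicts Nakayama's lemma.\<close>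

section \<open>Ideals of subrings\<close>

text \<open>Subrings are kept as subsets of an ambient domain, so that type-class determinants and
  polynomials apply to their elements.\<close>

locale subring_set =
  fixes R :: "'a::idom set"
  assumes one_mem: "1 \<in> R"
    and diff_mem: "x \<in> R \<Longrightarrow> y \<in> R \<Longrightarrow> x - y \<in> R"
    and mult_mem: "x \<in> R \<Longrightarrow> y \<in> R \<Longrightarrow> x * y \<in> R"
begin

lemma zero_mem: "0 \<in> R"
  using diff_mem[OF one_mem one_mem] by simp

lemma uminus_mem: "x \<in> R \<Longrightarrow> - x \<in> R"
  using diff_mem[OF zero_mem] by fastforce

lemma add_mem: "x \<in> R \<Longrightarrow> y \<in> R \<Longrightarrow> x + y \<in> R"
  using diff_mem[OF _ uminus_mem] by fastforce

lemma sum_mem: "(\<And>i. i \<in> S \<Longrightarrow> f i \<in> R) \<Longrightarrow> sum f S \<in> R"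
  by (induction S rule: infinite_finite_induct) (auto simp: zero_mem add_mem)

lemma prod_mem: "(\<And>i. i \<in> S \<Longrightarrow> f i \<in> R) \<Longrightarrow> prod f S \<in> R"
  by (induction S rule: infinite_finite_induct) (auto simp: one_mem mult_mem)

lemma power_mem: "x \<in> R \<Longrightarrow> x ^ n \<in> R"
  by (induction n) (auto simp: one_mem mult_mem)

lemma of_nat_mem: "of_nat n \<in> R"
  by (induction n) (auto simp: zero_mem one_mem add_mem)

lemma of_int_mem: "of_int n \<in> R"
  by (cases n) (auto simp: of_nat_mem intro!: uminus_mem diff_mem one_mem)

lemma signof_mem: "signof \<sigma> \<in> R"
  by (auto simp: sign_def one_mem uminus_mem)

lemma det_mem:
  assumes "A \<in> carrier_mat n n" "\<And>i j. i < n \<Longrightarrow> j < n \<Longrightarrow> A $$ (i, j) \<in> R"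
  shows "det A \<in> R"
  unfolding det_def'[OF assms(1)]
  by (intro sum_mem mult_mem signof_mem prod_mem assms(2))
     (auto dest: permutes_in_image)

lemma adj_mat_mem:
  assumes A: "A \<in> carrier_mat n n" and mem: "\<And>i j. i < n \<Longrightarrow> j < n \<Longrightarrow> A $$ (i, j) \<in> R"
    and ij: "i < n" "j < n"
  shows "adj_mat A $$ (i, j) \<in> R"
proof -
  have "det (mat_delete A j i) \<in> R"
    by (rule det_mem[OF mat_delete_carrier[OF A]])
       (use A ij in \<open>auto simp: mat_delete_def intro!: mem\<close>)
  then show ?thesis
    using A ij by (auto simp: adj_mat_def cofactor_def intro!: mult_mem power_mem uminus_mem one_mem)
qed

text \<open>Submodules of the ambient domain instead of ideals only: the entries of a kernel vector,
  and hence their span, need not lie in \<open>R\<close>.\<close>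

definition submodule :: "'a set \<Rightarrow> bool" where
  "submodule N \<longleftrightarrow> 0 \<in> N \<and> (\<forall>x\<in>N. \<forall>y\<in>N. x + y \<in> N) \<and> (\<forall>r\<in>R. \<forall>x\<in>N. r * x \<in> N)"

lemma submodule_zero: "submodule N \<Longrightarrow> 0 \<in> N"
  and submodule_add: "submodule N \<Longrightarrow> x \<in> N \<Longrightarrow> y \<in> N \<Longrightarrow> x + y \<in> N"
  and submodule_scale: "submodule N \<Longrightarrow> r \<in> R \<Longrightarrow> x \<in> N \<Longrightarrow> r * x \<in> N"
  by (auto simp: submodule_def)

lemma submodule_scale': "submodule N \<Longrightarrow> x \<in> N \<Longrightarrow> r \<in> R \<Longrightarrow> x * r \<in> N"
  using submodule_scale by (metis mult.commute)

lemma submodule_uminus: "submodule N \<Longrightarrow> x \<in> N \<Longrightarrow> - x \<in> N"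
  using submodule_scale[of N "-1" x] by (simp add: uminus_mem one_mem)

lemma submodule_diff: "submodule N \<Longrightarrow> x \<in> N \<Longrightarrow> y \<in> N \<Longrightarrow> x - y \<in> N"
  using submodule_add[of N x "- y"] by (simp add: submodule_uminus)

lemma submodule_sum: "submodule N \<Longrightarrow> (\<And>i. i \<in> S \<Longrightarrow> f i \<in> N) \<Longrightarrow> sum f S \<in> N"
  by (induction S rule: infinite_finite_induct) (auto simp: submodule_zero submodule_add)

lemma submodule_diff_iff: "submodule N \<Longrightarrow> x - y \<in> N \<Longrightarrow> x \<in> N \<longleftrightarrow> y \<in> N"
  using submodule_diff[of N x "x - y"] submodule_add[of N "x - y" y] by auto

lemma submodule_self: "submodule R"
  by (auto simp: submodule_def zero_mem add_mem mult_mem)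

lemma submodule_principal: "submodule ((*) c ` R)"
  unfolding submodule_def
proof (intro conjI ballI)
  show "0 \<in> (*) c ` R" using zero_mem by force
next
  fix x y assume "x \<in> (*) c ` R" "y \<in> (*) c ` R"
  then show "x + y \<in> (*) c ` R"
    by (auto simp flip: distrib_left intro!: imageI add_mem)
next
  fix r x assume r: "r \<in> R" and "x \<in> (*) c ` R"
  then obtain y where "y \<in> R" "x = c * y" by auto
  then show "r * x \<in> (*) c ` R"
    using r by (auto intro!: image_eqI[of _ _ "r * y"] mult_mem)
qed

end

text \<open>For \<open>C = R\<close> this is the span of the family \<open>w\<close>; for an ideal
  \<open>C = M\<close> it is \<open>M\<close> times that span.\<close>

definition comb_set :: "'a::comm_ring_1 set \<Rightarrow> 'i set \<Rightarrow> ('i \<Rightarrow> 'a) \<Rightarrow> 'a set" where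
  "comb_set C S w = {\<Sum>s\<in>S. c s * w s | c. \<forall>s\<in>S. c s \<in> C}"

lemma (in subring_set) submodule_comb_set:
  assumes "submodule C"
  shows "submodule (comb_set C S w)"
  unfolding submodule_def
proof (intro conjI ballI)
  show "0 \<in> comb_set C S w"
    unfolding comb_set_def using submodule_zero[OF assms]
    by (intro CollectI exI[of _ "\<lambda>_. 0"]) auto
next
  fix x y assume "x \<in> comb_set C S w" "y \<in> comb_set C S w"
  then obtain c d where "\<forall>s\<in>S. c s \<in> C" "\<forall>s\<in>S. d s \<in> C"
    "x = (\<Sum>s\<in>S. c s * w s)" "y = (\<Sum>s\<in>S. d s * w s)"
    by (auto simp: comb_set_def)
  then show "x + y \<in> comb_set C S w"
    unfolding comb_set_def using submodule_add[OF assms]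
    by (intro CollectI exI[of _ "\<lambda>s. c s + d s"]) (auto simp: distrib_right sum.distrib)
next
  fix r x assume "r \<in> R" "x \<in> comb_set C S w"
  then obtain c where "\<forall>s\<in>S. c s \<in> C" "x = (\<Sum>s\<in>S. c s * w s)"
    by (auto simp: comb_set_def)
  then show "r * x \<in> comb_set C S w"
    unfolding comb_set_def using submodule_scale[OF assms \<open>r \<in> R\<close>]
    by (intro CollectI exI[of _ "\<lambda>s. r * c s"]) (auto simp: sum_distrib_left mult.assoc)
qed

lemma comb_set_generator:
  assumes "finite S" "s \<in> S" "1 \<in> C" "0 \<in> C"
  shows "w s \<in> comb_set C S w"
  unfolding comb_set_def using assms
  by (intro CollectI exI[of _ "\<lambda>t. if t = s then 1 else 0"]) (auto simp: if_distrib[of "\<lambda>x. x * _"] cong: if_cong)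

locale subring_ideal = subring_set R for R :: "'a::idom set" +
  fixes M :: "'a set"
  assumes ideal: "submodule M" and ideal_subset: "M \<subseteq> R"
begin

lemma mult_cong:
  assumes "x \<in> R" "y' \<in> R" "x - x' \<in> M" "y - y' \<in> M"
  shows "x * y - x' * y' \<in> M"
proof -
  have "x * y - x' * y' = x * (y - y') + (x - x') * y'" by (simp add: algebra_simps)
  then show ?thesis
    using submodule_add[OF ideal submodule_scale[OF ideal assms(1,4)] submodule_scale'[OF ideal assms(3,2)]]
    by simp
qed

lemma add_cong: "x - x' \<in> M \<Longrightarrow> y - y' \<in> M \<Longrightarrow> (x + y) - (x' + y') \<in> M"
  using submodule_add[OF ideal, of "x - x'" "y - y'"] by (simp add: algebra_simps)

lemma sum_cong: "(\<And>i. i \<in> S \<Longrightarrow> f i - g i \<in> M) \<Longrightarrow> sum f S - sum g S \<in> M"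
  using submodule_sum[OF ideal, of S "\<lambda>i. f i - g i"] by (simp add: sum_subtractf)

lemma prod_cong:
  assumes "\<And>i. i \<in> S \<Longrightarrow> f i \<in> R" "\<And>i. i \<in> S \<Longrightarrow> g i \<in> R" "\<And>i. i \<in> S \<Longrightarrow> f i - g i \<in> M"
  shows "prod f S - prod g S \<in> M"
  using assms
  by (induction S rule: infinite_finite_induct)
     (auto simp: submodule_zero[OF ideal] intro!: mult_cong prod_mem)

lemma power_cong:
  assumes "x \<in> R" "y \<in> R" "x - y \<in> M"
  shows "x ^ n - y ^ n \<in> M"
  using prod_cong[of "{..<n}" "\<lambda>_. x" "\<lambda>_. y"] assms by simp

lemma det_cong:
  assumes A: "A \<in> carrier_mat n n" "\<And>i j. i < n \<Longrightarrow> j < n \<Longrightarrow> A $$ (i, j) \<in> R"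
    and B: "B \<in> carrier_mat n n" "\<And>i j. i < n \<Longrightarrow> j < n \<Longrightarrow> B $$ (i, j) \<in> R"
    and AB: "\<And>i j. i < n \<Longrightarrow> j < n \<Longrightarrow> A $$ (i, j) - B $$ (i, j) \<in> M"
  shows "det A - det B \<in> M"
  unfolding det_def'[OF A(1)] det_def'[OF B(1)]
proof (rule sum_cong)
  fix \<sigma> assume "\<sigma> \<in> {\<sigma>. \<sigma> permutes {0..<n}}"
  then have lt: "\<And>i. i < n \<Longrightarrow> \<sigma> i < n" by (auto dest: permutes_in_image)
  show "signof \<sigma> * (\<Prod>i = 0..<n. A $$ (i, \<sigma> i)) - signof \<sigma> * (\<Prod>i = 0..<n. B $$ (i, \<sigma> i)) \<in> M"
    using lt A B AB by (intro mult_cong prod_cong signof_mem prod_mem) (auto simp: submodule_zero[OF ideal])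
qed

text \<open>Determinant trick: if \<open>A\<close> collects the coefficients, then \<open>1 - A\<close> annihilates \<open>v\<close> and has
  determinant \<open>1\<close> modulo \<open>M\<close>.\<close>

lemma nakayama:
  fixes v :: "nat \<Rightarrow> 'a"
  assumes v: "\<And>s. s < n \<Longrightarrow> v s \<in> comb_set M {..<n} v" and nz: "s0 < n" "v s0 \<noteq> 0"
  shows "1 \<in> M"
proof -
  have "\<forall>s\<in>{..<n}. \<exists>c. (\<forall>t<n. c t \<in> M) \<and> v s = (\<Sum>t<n. c t * v t)"
    using v unfolding comb_set_def by fastforce
  then obtain c where c: "\<And>s t. s < n \<Longrightarrow> t < n \<Longrightarrow> c s t \<in> M"
    and eq: "\<And>s. s < n \<Longrightarrow> v s = (\<Sum>t<n. c s t * v t)"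
    by (metis lessThan_iff)
  define B where "B = mat n n (\<lambda>(i, j). (if i = j then 1 else 0) - c i j)"
  have B: "B \<in> carrier_mat n n" by (simp add: B_def)
  have "B *\<^sub>v vec n v = 0\<^sub>v n"
  proof (rule eq_vecI)
    fix i assume "i < dim_vec (0\<^sub>v n :: 'a vec)"
    then have i: "i < n" by simp
    have "(B *\<^sub>v vec n v) $ i = (\<Sum>j<n. ((if i = j then 1 else 0) - c i j) * v j)"
      using i by (simp add: B_def scalar_prod_def atLeast0LessThan)
    also have "\<dots> = (\<Sum>j<n. (if i = j then v j else 0)) - (\<Sum>j<n. c i j * v j)"
      unfolding sum_subtractf[symmetric] by (intro sum.cong) (auto simp: algebra_simps)
    also have "\<dots> = 0" using eq[OF i] i by simp
    finally show "(B *\<^sub>v vec n v) $ i = 0\<^sub>v n $ i" using i by simp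
  qed (simp add: B_def)
  moreover have "vec n v \<noteq> 0\<^sub>v n"
  proof
    assume "vec n v = 0\<^sub>v n"
    then have "vec n v $ s0 = 0\<^sub>v n $ s0" by simp
    with nz show False by simp
  qed
  ultimately have "det B = 0"
    unfolding det_0_iff_vec_prod_zero[OF B] by (intro exI[of _ "vec n v"]) auto
  moreover have "det (1\<^sub>m n) - det B \<in> M"
    by (rule det_cong[where n = n])
       (use c ideal_subset in \<open>auto simp: B_def one_mem zero_mem subset_eq intro!: diff_mem uminus_mem\<close>)
  ultimately show ?thesis by simp
qed

end

text \<open>Maximality is stated as invertibility modulo \<open>M\<close>, the form in which linear
  algebra over the residue field uses it.\<close>

locale subring_maximal_ideal = subring_ideal R M for R M :: "'a::idom set" +
  assumes proper: "1 \<notin> M"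
    and inverse_mod: "d \<in> R \<Longrightarrow> d \<notin> M \<Longrightarrow> \<exists>e\<in>R. e * d - 1 \<in> M"

text \<open>Zorn's lemma for the proper ideals that contain \<open>M\<close>. For \<open>d\<close>
  outside a maximal one, the ideal generated by it and \<open>d\<close> contains 1, which yields the
  inverse of \<open>d\<close>.\<close>

lemma (in subring_ideal) ex_maximal_ideal:
  assumes "1 \<notin> M"
  shows "\<exists>M'. M \<subseteq> M' \<and> subring_maximal_ideal R M'"
proof -
  define \<A> where "\<A> = {J. submodule J \<and> M \<subseteq> J \<and> J \<subseteq> R \<and> 1 \<notin> J}"
  have "M \<in> \<A>" using assms ideal ideal_subset by (auto simp: \<A>_def)
  have "\<exists>M'\<in>\<A>. \<forall>X\<in>\<A>. M' \<subseteq> X \<longrightarrow> X = M'"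
  proof (rule subset_Zorn_nonempty)
    show "\<A> \<noteq> {}" using \<open>M \<in> \<A>\<close> by auto
    fix \<C> assume C: "\<C> \<noteq> {}" "subset.chain \<A> \<C>"
    then have sub: "\<C> \<subseteq> \<A>" and lin: "\<And>X Y. X \<in> \<C> \<Longrightarrow> Y \<in> \<C> \<Longrightarrow> X \<subseteq> Y \<or> Y \<subseteq> X"
      by (auto simp: subset_chain_def)
    have "submodule (\<Union>\<C>)"
      unfolding submodule_def
    proof (intro conjI ballI)
      from C obtain X where "X \<in> \<C>" by blast
      then show "0 \<in> \<Union>\<C>" using sub submodule_zero[of X] by (auto simp: \<A>_def)
    next
      fix x y assume "x \<in> \<Union>\<C>" "y \<in> \<Union>\<C>"
      then obtain X where "X \<in> \<C>" "x \<in> X" "y \<in> X" using lin by blast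
      then show "x + y \<in> \<Union>\<C>" using sub submodule_add[of X x y] by (auto simp: \<A>_def)
    next
      fix r x assume "r \<in> R" "x \<in> \<Union>\<C>"
      then obtain X where "r \<in> R" "X \<in> \<C>" "x \<in> X" by blast
      then show "r * x \<in> \<Union>\<C>" using sub submodule_scale[of X r x] by (auto simp: \<A>_def)
    qed
    then show "\<Union>\<C> \<in> \<A>" using C sub by (auto simp: \<A>_def)
  qed
  then obtain M' where M': "M' \<in> \<A>" and max: "\<And>X. X \<in> \<A> \<Longrightarrow> M' \<subseteq> X \<Longrightarrow> X = M'" by blast
  have sm: "submodule M'" using M' by (simp add: \<A>_def)
  have "\<exists>e\<in>R. e * d - 1 \<in> M'" if d: "d \<in> R" "d \<notin> M'" for d
  proof -
    define X where "X = {m + e * d | m e. m \<in> M' \<and> e \<in> R}"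
    have "M' \<subseteq> X" unfolding X_def using zero_mem by force
    have "d \<in> X" unfolding X_def using submodule_zero[OF sm] one_mem by force
    then have "X \<notin> \<A>" using max[of X] d \<open>M' \<subseteq> X\<close> by auto
    moreover have "submodule X"
      unfolding submodule_def
    proof (intro conjI ballI)
      show "0 \<in> X" using \<open>M' \<subseteq> X\<close> submodule_zero[OF sm] by auto
    next
      fix x y assume "x \<in> X" "y \<in> X"
      then obtain m e m' e' where "x = m + e * d" "y = m' + e' * d" "m \<in> M'" "m' \<in> M'" "e \<in> R" "e' \<in> R"
        by (auto simp: X_def)
      then show "x + y \<in> X"
        unfolding X_def
        by (intro CollectI exI[of _ "m + m'"] exI[of _ "e + e'"])
           (auto simp: algebra_simps add_mem submodule_add[OF sm])
    next
      fix r x assume "r \<in> R" "x \<in> X"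
      then obtain m e where "x = m + e * d" "m \<in> M'" "e \<in> R"
        by (auto simp: X_def)
      then show "r * x \<in> X"
        unfolding X_def using \<open>r \<in> R\<close>
        by (intro CollectI exI[of _ "r * m"] exI[of _ "r * e"])
           (auto simp: distrib_left mult.assoc mult_mem submodule_scale[OF sm])
    qed
    moreover have "M \<subseteq> X" "X \<subseteq> R"
      using M' \<open>M' \<subseteq> X\<close> d by (auto simp: \<A>_def X_def intro!: add_mem mult_mem)
    ultimately have "1 \<in> X" by (auto simp: \<A>_def)
    then obtain m e where "1 = m + e * d" "m \<in> M'" "e \<in> R" by (auto simp: X_def)
    then have "e * d - 1 = - m" by (simp add: algebra_simps)
    then show ?thesis using \<open>e \<in> R\<close> \<open>m \<in> M'\<close> submodule_uminus[OF sm] by metis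
  qed
  then have "subring_maximal_ideal R M'"
    using M' by unfold_locales (auto simp: \<A>_def)
  then show ?thesis using M' by (auto simp: \<A>_def)
qed

section \<open>Linear algebra modulo a maximal ideal\<close>

text \<open>\<open>ideal_times\<close> makes \<open>W / (W \<inter> N)\<close> a vector space over
  the residue field \<open>R / M\<close>. In the application \<open>W\<close> is the span of a
  kernel vector and \<open>N\<close> is \<open>M\<close> times that span.\<close>

locale residue_module = subring_maximal_ideal R M for R M :: "'a::field_char_0 set" +
  fixes W N :: "'a set"
  assumes W: "submodule W" and N: "submodule N"
    and ideal_times: "m \<in> M \<Longrightarrow> x \<in> W \<Longrightarrow> m * x \<in> N"
begin

text \<open>If \<open>e\<close> inverts \<open>d\<close> modulo \<open>M\<close>, then
  \<open>x\<close> differs from \<open>e * (d * x)\<close> by an element of \<open>M * W\<close>,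
  hence of \<open>N\<close>.\<close>

lemma cancel_unit:
  assumes "d \<in> R" "d \<notin> M" "x \<in> W" "d * x \<in> N"
  shows "x \<in> N"
proof -
  obtain e where e: "e \<in> R" "e * d - 1 \<in> M" using inverse_mod assms by blast
  have "x = e * (d * x) - (e * d - 1) * x" by (simp add: algebra_simps)
  also have "\<dots> \<in> N"
    by (rule submodule_diff[OF N submodule_scale[OF N e(1) assms(4)] ideal_times[OF e(2) assms(3)]])
  finally show ?thesis .
qed

text \<open>Multiplication by the adjugate gives \<open>det B * u j \<in> N\<close> without
  division, and \<open>det B\<close> is a unit modulo \<open>M\<close>.\<close>

lemma solve_linear_system:
  assumes B: "B \<in> carrier_mat n n" "\<And>i j. i < n \<Longrightarrow> j < n \<Longrightarrow> B $$ (i, j) \<in> R"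
    and det: "det B \<notin> M"
    and u: "\<And>j. j < n \<Longrightarrow> u j \<in> W"
    and eq: "\<And>i. i < n \<Longrightarrow> (\<Sum>j<n. B $$ (i, j) * u j) \<in> N"
    and j: "j < n"
  shows "u j \<in> N"
proof (rule cancel_unit[OF det_mem[OF B] det u[OF j]])
  let ?A = "adj_mat B"
  have A: "?A \<in> carrier_mat n n" using adj_mat(1)[OF B(1)] .
  have "(\<Sum>i<n. ?A $$ (j, i) * (\<Sum>l<n. B $$ (i, l) * u l)) = (\<Sum>l<n. (\<Sum>i<n. ?A $$ (j, i) * B $$ (i, l)) * u l)"
    unfolding sum_distrib_left sum_distrib_right by (subst sum.swap) (simp add: mult.assoc)
  also have "\<dots> = (\<Sum>l<n. (?A * B) $$ (j, l) * u l)"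
    using A B(1) j by (intro sum.cong) (auto simp: scalar_prod_def atLeast0LessThan)
  also have "\<dots> = (\<Sum>l<n. (if j = l then det B * u l else 0))"
    unfolding adj_mat(3)[OF B(1)] using j by (intro sum.cong) auto
  also have "\<dots> = det B * u j" using j by simp
  finally have "det B * u j = (\<Sum>i<n. ?A $$ (j, i) * (\<Sum>l<n. B $$ (i, l) * u l))" by simp
  also have "\<dots> \<in> N"
    by (rule submodule_sum[OF N], rule submodule_scale[OF N adj_mat_mem[OF B j] eq]) auto
  finally show "det B * u j \<in> N" .
qed auto


end

context subring_maximal_ideal
begin

lemma ideal_prime:
  assumes "x \<in> R" "y \<in> R" "x * y \<in> M"
  shows "x \<in> M \<or> y \<in> M"
proof (rule disjCI)
  assume "y \<notin> M"
  then obtain e where e: "e \<in> R" "e * y - 1 \<in> M" using inverse_mod assms by blast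
  have "x = e * (x * y) - x * (e * y - 1)" by (simp add: algebra_simps)
  also have "\<dots> \<in> M"
    by (rule submodule_diff[OF ideal submodule_scale[OF ideal e(1) assms(3)] submodule_scale[OF ideal assms(1) e(2)]])
  finally show "x \<in> M" .
qed

lemma prod_notin_ideal:
  assumes "\<And>i. i \<in> S \<Longrightarrow> f i \<in> R" "\<And>i. i \<in> S \<Longrightarrow> f i \<notin> M"
  shows "prod f S \<notin> M"
  using assms
proof (induction S rule: infinite_finite_induct)
  case (insert x F)
  then show ?case using ideal_prime[of "f x" "prod f F"] prod_mem[of F f] by auto
qed (auto simp: proper)

lemma power_in_ideal: "x \<in> R \<Longrightarrow> x ^ n \<in> M \<Longrightarrow> x \<in> M"
  using prod_notin_ideal[of "{..<n}" "\<lambda>_. x"] by auto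

end

context residue_module
begin

text \<open>The binomial moments control the moments of all polynomials over \<open>R\<close> of
  degree below \<open>card B\<close>, among them the one that vanishes on \<open>B\<close> except at
  \<open>b\<close>. Its value at \<open>b\<close> is a unit modulo \<open>M\<close>.\<close>

lemma vandermonde_binomial:
  fixes w :: "nat \<Rightarrow> 'a"
  assumes B: "finite B" and w: "\<And>b. b \<in> B \<Longrightarrow> w b \<in> W"
    and distinct: "\<And>b c. b \<in> B \<Longrightarrow> c \<in> B \<Longrightarrow> b \<noteq> c \<Longrightarrow> of_nat b - of_nat c \<notin> M"
    and eq: "\<And>k. k < card B \<Longrightarrow> (\<Sum>b\<in>B. of_nat (b choose k) * w b) \<in> N"
    and b: "b \<in> B"
  shows "w b \<in> N"
proof -
  \<comment> \<open>The falling factorial of degree \<open>k\<close>, with value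
    \<open>fact k * (c choose k)\<close> at \<open>c\<close>. Being monic, it allows leading terms
    to be removed without division, and the factor \<open>fact k\<close> lies in
    \<open>R\<close>.\<close>
  define ff :: "nat \<Rightarrow> 'a poly" where "ff k = (\<Prod>i<k. [:- of_nat i, 1:])" for k
  have ff_deg: "degree (ff k) = k" for k
    by (simp add: ff_def degree_prod_eq_sum_degree)
  have ff_lead: "coeff (ff k) k = 1" for k
    using lead_coeff_prod[of "\<lambda>i. [:- of_nat i, 1::'a:]" "{..<k}"] ff_deg[of k] by (simp add: ff_def)
  have ff_poly: "poly (ff k) (of_nat c) = fact k * of_nat (c choose k)" for k c
  proof -
    have "poly (ff k) (of_nat c) = (\<Prod>i<k. of_nat c - of_nat i)"
      by (simp add: ff_def poly_prod)
    then show ?thesis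
      by (simp add: binomial_gbinomial gbinomial_prod_rev atLeast0LessThan)
  qed
  have lin_coeffs: "\<forall>i. coeff (\<Prod>c\<in>C. [:- of_nat c, 1::'a:]) i \<in> R" for C :: "nat set"
  proof (induction C rule: infinite_finite_induct)
    case (insert c C)
    show ?case
    proof
      fix i
      have "coeff ([:- of_nat c, 1:] * (\<Prod>c\<in>C. [:- of_nat c, 1::'a:])) i =
          - of_nat c * coeff (\<Prod>c\<in>C. [:- of_nat c, 1::'a:]) i +
          (case i of 0 \<Rightarrow> 0 | Suc j \<Rightarrow> coeff (\<Prod>c\<in>C. [:- of_nat c, 1::'a:]) j)"
        by (simp add: coeff_pCons)
      then show "coeff (\<Prod>c\<in>insert c C. [:- of_nat c, 1::'a:]) i \<in> R"
        using insert by (auto split: nat.splits simp: zero_mem intro!: add_mem diff_mem mult_mem uminus_mem of_nat_mem)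
    qed
  qed (auto simp: coeff_1 zero_mem one_mem)
  have all_polys: "(\<Sum>b\<in>B. poly f (of_nat b) * w b) \<in> N"
    if "k \<le> card B" "\<forall>i. coeff f i \<in> R" "\<forall>i\<ge>k. coeff f i = 0" for f k
    using that
  proof (induction k arbitrary: f)
    case 0
    then have "f = 0" by (auto simp: poly_eq_iff)
    then show ?case by (simp add: submodule_zero[OF N])
  next
    case (Suc k)
    let ?a = "coeff f k"
    let ?g = "f - smult ?a (ff k)"
    have "\<forall>i\<ge>k. coeff ?g i = 0"
    proof (intro allI impI)
      fix i assume "k \<le> i"
      then show "coeff ?g i = 0"
        using ff_lead[of k] ff_deg[of k] Suc.prems(3) by (cases "i = k") (auto simp: coeff_eq_0)
    qed
    moreover have "\<forall>i. coeff ?g i \<in> R"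
      using Suc.prems(2) lin_coeffs[of "{..<k}"] by (auto simp: ff_def intro!: diff_mem mult_mem)
    ultimately have g: "(\<Sum>b\<in>B. poly ?g (of_nat b) * w b) \<in> N"
      using Suc.IH[OF Suc_leD[OF Suc.prems(1)]] by blast
    have "(\<Sum>b\<in>B. poly f (of_nat b) * w b) =
        (\<Sum>b\<in>B. poly ?g (of_nat b) * w b) + ?a * fact k * (\<Sum>b\<in>B. of_nat (b choose k) * w b)"
      unfolding sum_distrib_left sum.distrib[symmetric]
      by (intro sum.cong refl) (simp add: ff_poly left_diff_distrib)
    moreover have "?a * fact k \<in> R" using Suc.prems(2) of_nat_mem[of "fact k"] by (simp add: mult_mem)
    ultimately show ?case
      using g eq[of k] Suc.prems(1) by (auto intro!: submodule_add[OF N] submodule_scale[OF N])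
  qed
  define f where "f = (\<Prod>c\<in>B - {b}. [:- of_nat c, 1::'a:])"
  have "degree f = card (B - {b})"
    by (simp add: f_def degree_prod_eq_sum_degree)
  then have "\<forall>i\<ge>card B. coeff f i = 0"
    using card_Diff1_less[OF B b] by (auto intro!: coeff_eq_0)
  then have "(\<Sum>c\<in>B. poly f (of_nat c) * w c) \<in> N"
    using all_polys[of "card B" f] lin_coeffs[of "B - {b}"] by (simp add: f_def)
  also have "(\<Sum>c\<in>B. poly f (of_nat c) * w c) = (\<Sum>c\<in>{b}. poly f (of_nat c) * w c)"
    using B b by (intro sum.mono_neutral_right) (auto simp: f_def poly_prod)
  finally have "poly f (of_nat b) * w b \<in> N" by simp
  moreover have "poly f (of_nat b) = (\<Prod>c\<in>B - {b}. of_nat b - of_nat c)"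
    by (simp add: f_def poly_prod)
  moreover have "(\<Prod>c\<in>B - {b}. of_nat b - of_nat c) \<notin> M"
    using distinct b by (intro prod_notin_ideal) (auto intro!: diff_mem of_nat_mem)
  moreover have "(\<Prod>c\<in>B - {b}. of_nat b - of_nat c) \<in> R"
    by (intro prod_mem diff_mem of_nat_mem)
  ultimately show ?thesis using cancel_unit w b by auto
qed

text \<open>With \<open>m a k\<close> the \<open>k\<close>-th binomial moment of the weights \<open>w a\<close>, the induction on \<open>k\<close> shows
  that all \<open>m a k\<close> vanish modulo \<open>N\<close>: if \<open>k \<ge> card (I a)\<close>, then \<open>w a\<close> itself vanishes by the
  previous moments, and the remaining moments satisfy a system with a principal minor of the
  Fourier matrix as its determinant.\<close>

lemma moments_vanish:
  fixes w :: "nat \<Rightarrow> nat \<Rightarrow> 'a"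
  assumes z: "z \<in> R"
    and fin: "\<And>a. a < p \<Longrightarrow> finite (I a)"
    and w: "\<And>a b. a < p \<Longrightarrow> b \<in> I a \<Longrightarrow> w a b \<in> W"
    and distinct: "\<And>a b c. a < p \<Longrightarrow> b \<in> I a \<Longrightarrow> c \<in> I a \<Longrightarrow> b \<noteq> c \<Longrightarrow> of_nat b - of_nat c \<notin> M"
    and minors: "\<And>S. S \<subseteq> {..<p} \<Longrightarrow> det (submatrix (mat p p (\<lambda>(j, k). z ^ (j * k))) S S) \<notin> M"
    and eq: "\<And>a k. a < p \<Longrightarrow> k < card (I a) \<Longrightarrow>
      (\<Sum>a'<p. z ^ (a * a') * (\<Sum>b\<in>I a'. of_nat (b choose k) * w a' b)) \<in> N"
    and ab: "a < p" "b \<in> I a"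
  shows "w a b \<in> N"
proof -
  define m where "m a k = (\<Sum>b\<in>I a. of_nat (b choose k) * w a b)" for a k
  have m_W: "a < p \<Longrightarrow> m a k \<in> W" for a k
    unfolding m_def using w by (intro submodule_sum[OF W] submodule_scale[OF W] of_nat_mem)
  have w_N: "w a b \<in> N" if "a < p" "b \<in> I a" "\<And>k. k < card (I a) \<Longrightarrow> m a k \<in> N" for a b
    using that vandermonde_binomial[of "I a" "w a" b] fin w distinct by (auto simp: m_def)
  have m_N: "a < p \<Longrightarrow> m a k \<in> N" for a k
  proof (induction k arbitrary: a rule: less_induct)
    case (less k)
    have small: "m a' k \<in> N" if "a' < p" "card (I a') \<le> k" for a'
      unfolding m_def using that less.IH
      by (intro submodule_sum[OF N] submodule_scale[OF N] of_nat_mem w_N) auto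
    \<comment> \<open>The equations of order \<open>k\<close> are given exactly for the rows in
      \<open>S\<close>, and by \<open>small\<close> the unknowns outside \<open>S\<close> already
      vanish modulo \<open>N\<close>. Rows and columns of the remaining system thus agree, which is
      why principal minors suffice.\<close>
    define S where "S = {a. a < p \<and> k < card (I a)}"
    have S: "S \<subseteq> {..<p}" "finite S" by (auto simp: S_def)
    have S_eq: "{i. i < p \<and> i \<in> S} = S" using S by auto
    have pick: "pick S i \<in> S" if "i < card S" for i using that pick_in_set_le by blast
    have pick_bij: "bij_betw (pick S) {..<card S} S"
    proof (rule bij_betwI[where g = "\<lambda>s. card {a \<in> S. a < s}"])
      show "(\<lambda>s. card {a \<in> S. a < s}) \<in> S \<rightarrow> {..<card S}"
        using S(2) by (auto intro!: psubset_card_mono)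
    qed (use pick pick_card_in_set card_pick_le in auto)
    let ?B = "submatrix (mat p p (\<lambda>(j, k). z ^ (j * k))) S S"
    have B: "?B \<in> carrier_mat (card S) (card S)"
      using S_eq by (intro carrier_matI) (auto simp: dim_submatrix)
    have B_ij: "?B $$ (i, j) = z ^ (pick S i * pick S j)" if "i < card S" "j < card S" for i j
      using that S_eq pick S by (auto simp: submatrix_index subset_eq)
    show ?case
    proof (cases "a \<in> S")
      case False
      then show ?thesis using small less.prems by (auto simp: S_def)
    next
      case True
      have sys: "(\<Sum>j<card S. ?B $$ (i, j) * m (pick S j) k) \<in> N" if i: "i < card S" for i
      proof -
        let ?f = "\<lambda>a'. z ^ (pick S i * a') * m a' k"
        have "(\<Sum>j<card S. ?B $$ (i, j) * m (pick S j) k) = (\<Sum>j<card S. ?f (pick S j))"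
          using B_ij i by (intro sum.cong) auto
        also have "\<dots> = sum ?f S" using sum.reindex_bij_betw[OF pick_bij] .
        also have "\<dots> = sum ?f {..<p} - sum ?f ({..<p} - S)"
          using S by (simp add: sum_diff)
        also have "\<dots> \<in> N"
        proof (rule submodule_diff[OF N])
          show "sum ?f {..<p} \<in> N" using eq[of "pick S i" k] pick[OF i] by (auto simp: m_def S_def)
          show "sum ?f ({..<p} - S) \<in> N"
            by (intro submodule_sum[OF N] submodule_scale[OF N] power_mem z small) (auto simp: S_def)
        qed
        finally show ?thesis .
      qed
      obtain j where j: "j < card S" "a = pick S j" using True pick_bij by (auto simp: bij_betw_def)
      have "m (pick S j) k \<in> N"
        by (rule solve_linear_system[OF B _ _ _ _ j(1)])
           (use S pick m_W sys minors[of S] in \<open>auto simp: B_ij subset_eq intro!: power_mem z\<close>)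
      then show ?thesis using j by simp
    qed
  qed
  show ?thesis using w_N m_N ab by blast
qed

end

section \<open>Divided differences of powers\<close>

text \<open>Complete homogeneous symmetric polynomials and, by way of them, divided differences of
  powers: \<open>divdiff xs j\<close> is the divided difference of \<open>x ^ j\<close> at the nodes \<open>xs\<close>.\<close>

fun hsym :: "'a::comm_ring_1 list \<Rightarrow> nat \<Rightarrow> 'a" where
  "hsym [] n = (if n = 0 then 1 else 0)"
| "hsym (x # xs) 0 = 1"
| "hsym (x # xs) (Suc n) = hsym xs (Suc n) + x * hsym (x # xs) n"

definition divdiff :: "'a::comm_ring_1 list \<Rightarrow> nat \<Rightarrow> 'a" where
  "divdiff xs j = (if Suc j < length xs then 0 else hsym xs (Suc j - length xs))"

lemma hsym_0 [simp]: "hsym xs 0 = 1"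
  by (cases xs) auto

lemma hsym_single [simp]: "hsym [x] n = x ^ n"
  by (induction n) auto

text \<open>Both sides satisfy the same recursion in \<open>n\<close>. This is the rule behind
  divided differences, stated without a quotient so that it holds in every commutative ring.\<close>

lemma hsym_diff: "hsym (x # zs) (Suc n) - hsym (y # zs) (Suc n) = (x - y) * hsym (x # y # zs) n"
proof (induction n)
  case (Suc n)
  have "hsym (x # zs) (Suc (Suc n)) - hsym (y # zs) (Suc (Suc n)) =
      x * (hsym (x # zs) (Suc n) - hsym (y # zs) (Suc n)) + (x - y) * hsym (y # zs) (Suc n)"
    unfolding hsym.simps(3)[of _ _ "Suc n"] by (simp add: algebra_simps del: hsym.simps)
  also have "\<dots> = (x - y) * hsym (x # y # zs) (Suc n)"
    unfolding Suc.IH hsym.simps(3)[of x "y # zs"] by (simp add: algebra_simps del: hsym.simps)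
  finally show ?case .
qed simp

lemma divdiff_Cons_Cons:
  "(x - y) * divdiff (x # y # zs) j = divdiff (x # zs) j - divdiff (y # zs) j"
\<comment> \<open>For \<open>j < length zs\<close> all terms are zero by the guard in
  \<open>divdiff\<close>, for \<open>j = length zs\<close> the right side is \<open>1 - 1\<close>,
  and beyond that \<open>hsym_diff\<close> applies.\<close>
proof (cases "Suc j - length zs")
  case 0
  then show ?thesis by (auto simp: divdiff_def)
next
  case (Suc n)
  then have j: "j = length zs + n" by simp
  show ?thesis
  proof (cases n)
    case (Suc n')
    then show ?thesis using hsym_diff[of x zs n' y] by (simp add: divdiff_def j del: hsym.simps)
  qed (simp add: divdiff_def j)
qed

text \<open>A divided difference at distinct nodes is a combination of the values at the nodes, so a
  relation that holds at each node passes to it. The induction drops either of the first two nodes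
  and cancels their difference.\<close>

lemma sum_divdiff_eq_0:
  fixes c :: "'i \<Rightarrow> 'a::idom"
  assumes "xs \<noteq> []" "distinct xs" "\<And>x. x \<in> set xs \<Longrightarrow> (\<Sum>s\<in>S. c s * x ^ e s) = 0"
  shows "(\<Sum>s\<in>S. c s * divdiff xs (e s)) = 0"
  using assms
proof (induction "length xs" arbitrary: xs rule: less_induct)
  case less
  show ?case
  \<comment> \<open>\<open>remdups_adj.cases\<close> serves only to distinguish lists of zero, one
    and at least two elements.\<close>
  proof (cases xs rule: remdups_adj.cases)
    case 1
    then show ?thesis using less.prems by simp
  next
    case (2 x)
    then show ?thesis using less.prems(3)[of x] by (simp add: divdiff_def)
  next
    case (3 x y zs)
    have "(x - y) * (\<Sum>s\<in>S. c s * divdiff xs (e s)) =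
        (\<Sum>s\<in>S. c s * divdiff (x # zs) (e s)) - (\<Sum>s\<in>S. c s * divdiff (y # zs) (e s))"
      unfolding 3 sum_distrib_left sum_subtractf[symmetric] right_diff_distrib[symmetric]
        divdiff_Cons_Cons[symmetric]
      by (simp add: mult_ac)
    also have "\<dots> = 0"
    proof -
      have "(\<Sum>s\<in>S. c s * divdiff (u # zs) (e s)) = 0" if "u \<in> {x, y}" for u
        using less.prems that unfolding 3 by (intro less.hyps) (auto simp: 3)
      then show ?thesis by simp
    qed
    finally show ?thesis using less.prems(2) 3 by simp
  qed
qed

context subring_ideal
begin

text \<open>If all \<open>k + 1\<close> variables equal 1, the polynomial counts the monomials of
  degree \<open>n\<close>, of which there are \<open>(n + k) choose k\<close>; its recursion becomes
  Pascal's rule.\<close>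

lemma hsym_cong:
  assumes "set xs \<subseteq> R" "\<And>x. x \<in> set xs \<Longrightarrow> x - 1 \<in> M" "length xs = Suc k"
  shows "hsym xs n - of_nat ((n + k) choose k) \<in> M"
  using assms
proof (induction xs n arbitrary: k rule: hsym.induct)
  case (2 x xs)
  then show ?case by (simp add: submodule_zero[OF ideal])
next
  case (3 x xs n)
  show ?case
  proof (cases k)
    case 0
    then show ?thesis
      using 3 power_cong[of x 1 "Suc n"] by (auto simp: one_mem)
  next
    case (Suc k')
    have "hsym xs (Suc n) - of_nat ((Suc n + k') choose k') \<in> M"
      using 3 Suc by auto
    moreover have "x * hsym (x # xs) n - 1 * of_nat ((n + k) choose k) \<in> M"
      using 3 by (intro mult_cong of_nat_mem) auto
    moreover have "(Suc n + k) choose k = ((Suc n + k') choose k') + ((n + k) choose k)"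
      using Suc by simp
    ultimately show ?thesis using add_cong by fastforce
  qed
qed auto

text \<open>At the \<open>(k + 1)\<close>-fold node 1 the divided difference of \<open>x ^ j\<close>
  is its Taylor coefficient of order \<open>k\<close>, namely \<open>j choose k\<close>.\<close>

lemma divdiff_cong:
  assumes "set xs \<subseteq> R" "\<And>x. x \<in> set xs \<Longrightarrow> x - 1 \<in> M" "length xs = Suc k"
  shows "divdiff xs j - of_nat (j choose k) \<in> M"
  using hsym_cong[OF assms, of "j - k"] assms(3)
  by (auto simp: divdiff_def binomial_eq_0 submodule_zero[OF ideal])

end

section \<open>Residue fields of cyclotomic rings\<close>

text \<open>The ring \<open>\<int>[z]\<close>, given by closure rules so that statements about its
  elements can be proved by induction.\<close>

inductive_set int_adjoin :: "'a::ring_1 \<Rightarrow> 'a set" for z where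
  int: "of_int k \<in> int_adjoin z"
| gen: "z \<in> int_adjoin z"
| diff: "x \<in> int_adjoin z \<Longrightarrow> y \<in> int_adjoin z \<Longrightarrow> x - y \<in> int_adjoin z"
| mult: "x \<in> int_adjoin z \<Longrightarrow> y \<in> int_adjoin z \<Longrightarrow> x * y \<in> int_adjoin z"

lemma subring_set_int_adjoin: "subring_set (int_adjoin (z :: 'a::idom))"
  using int_adjoin.int[of 1 z] by unfold_locales (auto intro: int_adjoin.intros)

interpretation int_adjoin: subring_set "int_adjoin (z :: 'a::idom)" for z
  by (rule subring_set_int_adjoin)

text \<open>The set of elements congruent to a combination of powers below \<open>n\<close> is a module over
  \<open>\<int>[z]\<close>; since it contains \<open>1\<close>, it is everything.\<close>

lemma int_adjoin_reduce:
  fixes z :: "'a::idom" and c :: "nat \<Rightarrow> int"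
  assumes J: "int_adjoin.submodule z J" and n: "n > 0"
    and rel: "z ^ n - (\<Sum>i<n. of_int (c i) * z ^ i) \<in> J"
    and x: "x \<in> int_adjoin z"
  shows "\<exists>a :: nat \<Rightarrow> int. x - (\<Sum>i<n. of_int (a i) * z ^ i) \<in> J"
proof -
  define T where "T = {x. \<exists>a :: nat \<Rightarrow> int. x - (\<Sum>i<n. of_int (a i) * z ^ i) \<in> J}"
  have T_int: "of_int k * t \<in> T" if t: "t \<in> T" for t k
  proof -
    obtain a :: "nat \<Rightarrow> int" where a: "t - (\<Sum>i<n. of_int (a i) * z ^ i) \<in> J" using t by (auto simp: T_def)
    have "of_int k * (t - (\<Sum>i<n. of_int (a i) * z ^ i)) \<in> J"
      by (rule int_adjoin.submodule_scale[OF J int_adjoin.int a])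
    also have "of_int k * (t - (\<Sum>i<n. of_int (a i) * z ^ i)) = of_int k * t - (\<Sum>i<n. of_int (k * a i) * z ^ i)"
      by (simp add: right_diff_distrib sum_distrib_left mult.assoc)
    finally show ?thesis unfolding T_def by (intro CollectI exI)
  qed
  have T_add: "s + t \<in> T" if st: "s \<in> T" "t \<in> T" for s t
  proof -
    obtain a b :: "nat \<Rightarrow> int" where a: "s - (\<Sum>i<n. of_int (a i) * z ^ i) \<in> J"
      and b: "t - (\<Sum>i<n. of_int (b i) * z ^ i) \<in> J" using st by (auto simp: T_def)
    have "(s - (\<Sum>i<n. of_int (a i) * z ^ i)) + (t - (\<Sum>i<n. of_int (b i) * z ^ i)) \<in> J"
      by (rule int_adjoin.submodule_add[OF J a b])
    also have "(s - (\<Sum>i<n. of_int (a i) * z ^ i)) + (t - (\<Sum>i<n. of_int (b i) * z ^ i)) =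
        s + t - (\<Sum>i<n. of_int (a i + b i) * z ^ i)"
      by (simp add: distrib_right sum.distrib)
    finally show ?thesis unfolding T_def by (intro CollectI exI)
  qed
  have T_J: "t \<in> T" if "t \<in> J" for t
    unfolding T_def using that by (intro CollectI exI[of _ "\<lambda>_. 0"]) auto
  have T_pow: "z ^ i \<in> T" if "i < n" for i
    unfolding T_def using that int_adjoin.submodule_zero[OF J]
    by (intro CollectI exI[of _ "\<lambda>j. if j = i then 1 else 0"]) (simp add: if_distrib[of of_int] if_distrib[of "\<lambda>x. x * _"] cong: if_cong)
  have T_sum: "sum f S \<in> T" if "\<And>i. i \<in> S \<Longrightarrow> f i \<in> T" for f :: "nat \<Rightarrow> 'a" and S
    using that
    by (induction S rule: infinite_finite_induct) (auto simp: T_add intro: T_J[OF int_adjoin.submodule_zero[OF J]])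
  \<comment> \<open>Multiplication by \<open>z\<close> leaves the range of exponents only for
    \<open>Suc i = n\<close>, where \<open>rel\<close> rewrites \<open>z ^ n\<close>.\<close>
  have T_pow_Suc: "z * z ^ i \<in> T" if "i < n" for i
  proof (cases "Suc i = n")
    case True
    have "z * z ^ i = (z ^ n - (\<Sum>i<n. of_int (c i) * z ^ i)) + (\<Sum>i<n. of_int (c i) * z ^ i)"
      using True by auto
    also have "\<dots> \<in> T"
      by (intro T_add T_J[OF rel] T_sum T_int T_pow) auto
    finally show ?thesis .
  next
    case False
    then show ?thesis using T_pow[of "Suc i"] that by simp
  qed
  have T_gen: "z * t \<in> T" if t: "t \<in> T" for t
  proof -
    obtain a :: "nat \<Rightarrow> int" where a: "t - (\<Sum>i<n. of_int (a i) * z ^ i) \<in> J" using t by (auto simp: T_def)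
    have "z * t = z * (t - (\<Sum>i<n. of_int (a i) * z ^ i)) + (\<Sum>i<n. of_int (a i) * (z * z ^ i))"
      by (simp add: right_diff_distrib sum_distrib_left mult_ac)
    also have "\<dots> \<in> T"
      by (intro T_add T_J int_adjoin.submodule_scale[OF J _ a] int_adjoin.gen T_sum T_int T_pow_Suc) auto
    finally show ?thesis .
  qed
  have "\<forall>t\<in>T. x * t \<in> T"
    using x
  proof induction
    case (diff x y)
    show ?case
    proof
      fix t assume "t \<in> T"
      then have "x * t + of_int (- 1) * (y * t) \<in> T" using diff by (intro T_add T_int) auto
      then show "(x - y) * t \<in> T" by (simp add: left_diff_distrib)
    qed
  qed (use T_int T_gen in \<open>auto simp: mult.assoc\<close>)
  moreover have "1 \<in> T" using T_pow[OF n] by simp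
  ultimately have "x * 1 \<in> T" by blast
  then show ?thesis by (simp add: T_def)
qed

text \<open>The powers \<open>z ^ i\<close> with \<open>i < n\<close> generate
  \<open>\<int>[z]\<close> over the integers. If \<open>q\<close> were invertible, each would be a
  combination of them with coefficients in \<open>q \<int>\<close>, against Nakayama's lemma over
  \<open>\<int>\<close>.\<close>

lemma int_adjoin_root_of_unity_proper:
  fixes z :: "'a::{idom,ring_char_0}"
  assumes q: "q > 1" and z: "z ^ n = 1" "n > 0"
  shows "1 \<notin> (*) (of_nat q) ` int_adjoin z"
proof
  assume "1 \<in> (*) (of_nat q) ` int_adjoin z"
  then obtain y where y: "y \<in> int_adjoin z" "1 = of_nat q * y" by auto
  interpret Z: subring_ideal "\<int> :: 'a set" "(*) (of_nat q) ` \<int>"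
  proof -
    interpret subring_set "\<int> :: 'a set" by unfold_locales auto
    show "subring_ideal (\<int> :: 'a set) ((*) (of_nat q) ` \<int>)"
      using submodule_principal[of "of_nat q"] by unfold_locales auto
  qed
  have "z ^ s \<in> comb_set ((*) (of_nat q) ` \<int>) {..<n} (\<lambda>i. z ^ i)" for s
  proof -
    have "\<exists>a :: nat \<Rightarrow> int. y * z ^ s - (\<Sum>i<n. of_int (a i) * z ^ i) \<in> {0}"
    proof (rule int_adjoin_reduce[where c = "\<lambda>i. if i = 0 then 1 else 0"])
      show "int_adjoin.submodule z {0}" by (auto simp: int_adjoin.submodule_def)
      show "y * z ^ s \<in> int_adjoin z"
        by (intro int_adjoin.mult_mem int_adjoin.power_mem int_adjoin.gen y)
    qed (use z in \<open>auto simp: if_distrib[of of_int] if_distrib[of "\<lambda>x. x * _"] cong: if_cong\<close>)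
    then obtain a :: "nat \<Rightarrow> int" where a: "y * z ^ s = (\<Sum>i<n. of_int (a i) * z ^ i)" by auto
    have "z ^ s = of_nat q * (y * z ^ s)" using y(2) by (simp flip: mult.assoc)
    also have "\<dots> = (\<Sum>i<n. (of_nat q * of_int (a i)) * z ^ i)"
      unfolding a by (simp add: sum_distrib_left mult.assoc)
    finally show ?thesis unfolding comb_set_def by (intro CollectI exI[of _ "\<lambda>i. of_nat q * of_int (a i)"]) auto
  qed
  then have "1 \<in> (*) (of_nat q) ` (\<int> :: 'a set)"
    using z(2) by (intro Z.nakayama[where n = n and v = "\<lambda>i. z ^ i" and ?s0.0 = 0]) auto
  then obtain k :: int where "(1 :: 'a) = of_nat q * of_int k" by (auto elim!: Ints_cases)
  then have "(of_int (int q * k) :: 'a) = of_int 1" by simp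
  then have "int q * k = 1" by (simp only: of_int_eq_iff)
  then show False using q by (auto simp: zmult_eq_1_iff)
qed

text \<open>Synthetic division splits off one root, and as \<open>M\<close> is prime the others
  remain roots of the quotient. This is the bound on the number of roots of a polynomial over the
  residue field.\<close>

lemma (in subring_maximal_ideal) coeffs_in_ideal_if_roots:
  assumes "degree f < n" "\<And>i. coeff f i \<in> R" "\<And>l. l < n \<Longrightarrow> x l \<in> R"
    and "\<And>l m. l < m \<Longrightarrow> m < n \<Longrightarrow> x l - x m \<notin> M"
    and "\<And>l. l < n \<Longrightarrow> poly f (x l) \<in> M"
  shows "coeff f i \<in> M"
  using assms
proof (induction n arbitrary: f i)
  case (Suc n)
  let ?g = "synthetic_div f (x n)"
  have root: "poly f (x n) \<in> M" using Suc.prems by simp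
  have coeff_f: "coeff f j = coeff (pCons (poly f (x n)) ?g) j - x n * coeff ?g j" for j
    using synthetic_div_correct[of f "x n"] by (metis add_diff_cancel_right' coeff_add coeff_smult)
  have g_R: "\<forall>j. coeff ?g j \<in> R"
    using Suc.prems(2)
  proof (induction f)
    case (pCons a f)
    have *: "coeff f i \<in> R" for i using pCons.prems[of "Suc i"] by simp
    have "poly f (x n) \<in> R"
      unfolding poly_altdef using * Suc.prems(3)[of n] by (intro sum_mem mult_mem power_mem) auto
    then show ?case using pCons.IH[OF *] by (auto simp: coeff_pCons split: nat.splits)
  qed (simp add: zero_mem)
  have g_M: "coeff ?g j \<in> M" for j
  proof (cases "degree f = 0")
    case True
    then have "?g = 0" by (simp add: synthetic_div_eq_0_iff)
    then show ?thesis by (simp add: submodule_zero[OF ideal])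
  next
    case False
    show ?thesis
    proof (rule Suc.IH)
      show "degree ?g < n" using False Suc.prems(1) by (simp add: degree_synthetic_div)
      fix l assume l: "l < n"
      have "poly f (x l) = (x l - x n) * poly ?g (x l) + poly f (x n)"
        by (subst synthetic_div_correct'[of "x n" f, symmetric]) (simp add: algebra_simps)
      then have "(x l - x n) * poly ?g (x l) \<in> M"
        using submodule_diff[OF ideal Suc.prems(5)[of l] root] l by (metis add_diff_cancel_right' less_SucI)
      moreover have "poly ?g (x l) \<in> R"
        unfolding poly_altdef using g_R Suc.prems(3)[of l] l by (intro sum_mem mult_mem power_mem) auto
      ultimately show "poly ?g (x l) \<in> M"
        using ideal_prime[of "x l - x n" "poly ?g (x l)"] Suc.prems(3)[of l] Suc.prems(3)[of n]
          Suc.prems(4)[of l n] l by (auto intro: diff_mem)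
    qed (use Suc.prems g_R in auto)
  qed
  have "coeff (pCons (poly f (x n)) ?g) i \<in> M" using root g_M by (auto simp: coeff_pCons split: nat.splits)
  then show ?case
    unfolding coeff_f[of i] using g_M Suc.prems(3)[of n]
    by (auto intro: submodule_diff[OF ideal] submodule_scale[OF ideal])
qed simp

text \<open>In the application \<open>z\<close> is a primitive root of unity of order
  \<open>p * q\<close>. By \<open>root\<close> and \<open>root_neq\<close>, \<open>z ^ q\<close> is
  a primitive \<open>p\<close>-th root of unity, and \<open>q_mem\<close> places \<open>M\<close>
  above \<open>q\<close>.\<close>

locale cyclotomic_residue =
  subring_maximal_ideal "int_adjoin z" M for z :: complex and M +
  fixes p q :: nat
  assumes prime_p: "prime p" and prime_q: "prime q" and odd_q: "odd q" and neq: "p \<noteq> q"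
    and root: "z ^ (p * q) = 1" and root_neq: "z ^ q \<noteq> 1"
    and q_mem: "of_nat q \<in> M"
begin

abbreviation "\<O> \<equiv> int_adjoin z"

lemma z_mem: "z ^ k \<in> \<O>"
  by (intro power_mem int_adjoin.gen)

text \<open>An integer in \<open>M\<close> prime to \<open>q\<close> would by Bezout put 1 into
  \<open>M\<close>.\<close>

lemma of_int_mem_iff: "of_int k \<in> M \<longleftrightarrow> int q dvd k"
proof
  assume "int q dvd k"
  then obtain l where "k = int q * l" by auto
  then have "(of_int k :: complex) = of_int l * of_nat q" by simp
  also have "\<dots> \<in> M" by (rule submodule_scale[OF ideal of_int_mem q_mem])
  finally show "of_int k \<in> M" .
next
  assume k: "of_int k \<in> M"
  show "int q dvd k"
  proof (rule ccontr)
    assume "\<not> int q dvd k"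
    then have "coprime (int q) k" using prime_q by (simp add: prime_imp_coprime)
    then obtain u v where "u * int q + v * k = 1" using bezout_int[of "int q" k] by (auto simp: coprime_iff_gcd_eq_1)
    then have "(of_int (u * int q + v * k) :: complex) = of_int 1" by simp
    then have "(1 :: complex) = of_int u * of_nat q + of_int v * of_int k" by simp
    also have "\<dots> \<in> M"
      by (intro submodule_add[OF ideal] submodule_scale[OF ideal] of_int_mem q_mem k)
    finally show False using proper by simp
  qed
qed

lemma frobenius_add:
  assumes "x \<in> \<O>" "y \<in> \<O>"
  shows "(x + y) ^ q - (x ^ q + y ^ q) \<in> M"
proof -
  have "q > 0" using prime_q prime_gt_0_nat by blast
  have "(x + y) ^ q = (\<Sum>k\<in>{..q}. of_nat (q choose k) * x ^ k * y ^ (q - k))"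
    by (rule binomial_ring)
  also have "\<dots> = (\<Sum>k\<in>{0,q}. of_nat (q choose k) * x ^ k * y ^ (q - k)) +
      (\<Sum>k\<in>{..q} - {0,q}. of_nat (q choose k) * x ^ k * y ^ (q - k))"
    by (subst sum.subset_diff[of "{0, q}" "{..q}"]) (auto simp: add.commute)
  finally have "(x + y) ^ q - (x ^ q + y ^ q) = (\<Sum>k\<in>{..q} - {0,q}. of_nat (q choose k) * x ^ k * y ^ (q - k))"
    using \<open>q > 0\<close> by simp
  also have "\<dots> \<in> M"
  proof (intro submodule_sum[OF ideal] submodule_scale'[OF ideal] power_mem assms)
    fix k assume "k \<in> {..q} - {0,q}"
    then have "q dvd (q choose k)" using prime_q by (intro dvd_choose_prime) auto
    then show "of_nat (q choose k) \<in> M" using of_int_mem_iff[of "int (q choose k)"] by simp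
  qed
  finally show ?thesis .
qed

lemma frobenius_of_nat: "of_nat k ^ q - of_nat k \<in> M"
proof (induction k)
  case 0
  then show ?case using prime_gt_0_nat[OF prime_q] by (simp add: submodule_zero[OF ideal] power_0_left)
next
  case (Suc k)
  have "of_nat (Suc k) ^ q - of_nat (Suc k) =
      ((of_nat k + 1) ^ q - (of_nat k ^ q + 1 ^ q)) + ((of_nat k :: complex) ^ q - of_nat k)"
    by (simp add: add.commute)
  also have "\<dots> \<in> M"
    by (intro submodule_add[OF ideal _ Suc] frobenius_add of_nat_mem one_mem)
  finally show ?case .
qed

lemma of_int_cong_mod: "of_int k - of_int (k mod int q) \<in> M"
  using of_int_mem_iff[of "k - k mod int q"] by (simp add: dvd_minus_mod)

lemma frobenius_of_int: "of_int k ^ q - of_int k \<in> M"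
proof -
  let ?r = "of_int (k mod int q) :: complex"
  have "k mod int q \<ge> 0" using prime_gt_0_nat[OF prime_q] by simp
  then have "?r = of_nat (nat (k mod int q))" by simp
  then have "?r ^ q - ?r \<in> M" using frobenius_of_nat by metis
  moreover have "of_int k ^ q - ?r ^ q \<in> M"
    by (intro power_cong of_int_mem of_int_cong_mod)
  moreover have "of_int k ^ q - of_int k = (of_int k ^ q - ?r ^ q) + (?r ^ q - ?r) - (of_int k - ?r)"
    by simp
  ultimately show ?thesis
    using of_int_cong_mod by (metis submodule_add[OF ideal] submodule_diff[OF ideal])
qed

text \<open>Frobenius is additive and fixes integers modulo \<open>M\<close>, so it acts on the
  value of an integer polynomial by acting on the argument.\<close>

lemma frobenius_poly:
  fixes c :: "nat \<Rightarrow> int"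
  assumes x: "x \<in> \<O>"
  shows "(\<Sum>i<n. of_int (c i) * x ^ i) ^ q - (\<Sum>i<n. of_int (c i) * (x ^ q) ^ i) \<in> M"
proof (induction n)
  case 0
  then show ?case using prime_gt_0_nat[OF prime_q] by (simp add: submodule_zero[OF ideal] power_0_left)
next
  case (Suc n)
  let ?s = "\<Sum>i<n. of_int (c i) * x ^ i" and ?t = "\<Sum>i<n. of_int (c i) * (x ^ q) ^ i"
  have 1: "(?s + of_int (c n) * x ^ n) ^ q - (?s ^ q + (of_int (c n) * x ^ n) ^ q) \<in> M"
    by (intro frobenius_add sum_mem mult_mem of_int_mem power_mem x)
  have 2: "(of_int (c n) ^ q - of_int (c n)) * (x ^ q) ^ n \<in> M"
    by (intro submodule_scale'[OF ideal] frobenius_of_int power_mem x)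
  have "(of_int (c n) * x ^ n) ^ q = of_int (c n) ^ q * (x ^ q) ^ n"
    by (simp add: power_mult_distrib mult.commute flip: power_mult)
  then have "(?s + of_int (c n) * x ^ n) ^ q - (?t + of_int (c n) * (x ^ q) ^ n) =
    ((?s + of_int (c n) * x ^ n) ^ q - (?s ^ q + (of_int (c n) * x ^ n) ^ q)) +
    ((?s ^ q - ?t) + (of_int (c n) ^ q - of_int (c n)) * (x ^ q) ^ n)"
    by (simp add: left_diff_distrib)
  also have "\<dots> \<in> M" by (intro submodule_add[OF ideal] 1 2 Suc)
  finally show ?case by simp
qed

text \<open>Modulo \<open>M\<close>, \<open>(x - 1) ^ q\<close> is \<open>x ^ q - 1 = 0\<close>,
  where \<open>(- 1) ^ q = - 1\<close> since \<open>q\<close> is odd; and \<open>M\<close> is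
  prime.\<close>

lemma root_of_order_q:
  assumes "x \<in> \<O>" "x ^ q = 1"
  shows "x - 1 \<in> M"
proof (rule power_in_ideal)
  show "(x - 1) ^ q \<in> M"
    using frobenius_add[of x "- 1"] assms odd_q by (simp add: uminus_mem one_mem)
qed (simp add: assms diff_mem one_mem)

lemma zp_cong_1: "z ^ p - 1 \<in> M"
  using root by (intro root_of_order_q z_mem) (simp add: power_mult)

text \<open>Otherwise the geometric sum of the powers of \<open>z ^ q\<close>, which is 0, would be
  congruent to \<open>p\<close>, and \<open>q\<close> would divide \<open>p\<close>.\<close>

lemma zq_not_cong_1: "z ^ q - 1 \<notin> M"
proof
  assume *: "z ^ q - 1 \<in> M"
  have "(\<Sum>i<p. (z ^ q) ^ i) - (\<Sum>i<p. 1 ^ i) \<in> M"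
    by (intro sum_cong power_cong z_mem one_mem *)
  moreover have "(\<Sum>i<p. (z ^ q) ^ i) = 0"
    using root root_neq geometric_sum[of "z ^ q" p] by (simp add: power_mult mult.commute[of p])
  ultimately have "of_int (int p) \<in> M"
    using submodule_uminus[OF ideal, of "- of_nat p"] by simp
  then have "q dvd p" unfolding of_int_mem_iff by simp
  then show False using prime_p prime_q neq primes_dvd_imp_eq by blast
qed

lemma z_power_cong: "[a = b] (mod p) \<Longrightarrow> z ^ a - z ^ b \<in> M"
proof -
  have *: "z ^ a - z ^ (a mod p) \<in> M" for a
  proof -
    have "(z ^ p) ^ (a div p) * z ^ (a mod p) - 1 ^ (a div p) * z ^ (a mod p) \<in> M"
      using mult_cong[OF power_mem[OF z_mem] z_mem power_cong[OF z_mem one_mem zp_cong_1]]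
        submodule_zero[OF ideal] by simp
    then show ?thesis by (simp flip: power_mult power_add)
  qed
  assume "[a = b] (mod p)"
  then have "z ^ a - z ^ b = (z ^ a - z ^ (a mod p)) - (z ^ b - z ^ (b mod p))" by (simp add: cong_def)
  then show ?thesis using *[of a] *[of b] submodule_diff[OF ideal] by metis
qed

lemma z_power_cong_1_iff: "z ^ k - 1 \<in> M \<longleftrightarrow> p dvd k"
proof
  assume "p dvd k"
  then show "z ^ k - 1 \<in> M" using z_power_cong[of k 0] by (simp add: cong_0_iff)
next
  assume k: "z ^ k - 1 \<in> M"
  show "p dvd k"
  proof (rule ccontr)
    assume "\<not> p dvd k"
    then have "coprime k p" using prime_p prime_imp_coprime coprime_commute by blast
    \<comment> \<open>With \<open>u\<close> inverse to \<open>k\<close> modulo \<open>p\<close>, the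
      exponent \<open>k * (u * q)\<close> is congruent to \<open>q\<close>, which leads back to
      \<open>zq_not_cong_1\<close>.\<close>
    then obtain u where "[k * u = 1] (mod p)" using cong_solve_coprime_nat by (metis One_nat_def)
    then have "[k * (u * q) = q] (mod p)"
      using cong_scalar_right[of "k * u" 1 p q] by (simp add: mult.assoc)
    then have "z ^ (k * (u * q)) - z ^ q \<in> M" by (rule z_power_cong)
    moreover have "(z ^ k) ^ (u * q) - 1 ^ (u * q) \<in> M" by (intro power_cong z_mem one_mem k)
    ultimately have "z ^ q - 1 \<in> M"
      using submodule_diff[OF ideal, of "(z ^ k) ^ (u * q) - 1" "z ^ (k * (u * q)) - z ^ q"]
      by (simp add: power_mult)
    then show False using zq_not_cong_1 by simp
  qed
qed

lemma z_power_cong_iff: "l \<le> m \<Longrightarrow> z ^ m - z ^ l \<in> M \<longleftrightarrow> p dvd m - l"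
proof -
  assume "l \<le> m"
  then have *: "z ^ m - z ^ l = z ^ l * (z ^ (m - l) - 1)"
    by (simp add: right_diff_distrib flip: power_add)
  have "z ^ l \<notin> M"
  proof
    assume "z ^ l \<in> M"
    \<comment> \<open>\<open>z ^ (l * (p * q - 1))\<close> is the inverse of
      \<open>z ^ l\<close>.\<close>
    then have "z ^ (l * (p * q - 1)) * z ^ l \<in> M" by (intro submodule_scale[OF ideal z_mem])
    also have "z ^ (l * (p * q - 1)) * z ^ l = (z ^ (p * q)) ^ l"
      using prime_gt_0_nat[OF prime_p] prime_gt_0_nat[OF prime_q]
      by (simp flip: power_add power_mult) (metis (no_types, opaque_lifting) add.commute mult.commute mult_Suc_right Suc_pred nat_0_less_mult_iff)
    finally show False using root proper by simp
  qed
  then have "z ^ m - z ^ l \<in> M \<longleftrightarrow> z ^ (m - l) - 1 \<in> M"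
    unfolding * using ideal_prime[of "z ^ l" "z ^ (m - l) - 1"] submodule_scale[OF ideal z_mem]
    by (auto intro: z_mem diff_mem one_mem)
  then show ?thesis by (simp add: z_power_cong_1_iff)
qed

text \<open>Modulo \<open>M\<close>, \<open>z\<close> is a \<open>p\<close>-th root of unity other
  than 1, so \<open>1 + z + ... + z ^ (p - 1)\<close> vanishes there and the exponents can be kept
  below \<open>p - 1\<close>. The coefficients are then reduced modulo \<open>q\<close>.\<close>

lemma residue_representative:
  assumes "x \<in> \<O>"
  shows "\<exists>a \<in> {..<p - 1} \<rightarrow>\<^sub>E {0..<int q}. x - (\<Sum>i<p - 1. of_int (a i) * z ^ i) \<in> M"
proof -
  have p: "p - 1 > 0" "p = Suc (p - 1)" using prime_gt_1_nat[OF prime_p] by auto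
  have "z - 1 \<notin> M" using z_power_cong_1_iff[of 1] prime_gt_1_nat[OF prime_p] by auto
  moreover have "(z - 1) * (\<Sum>i<p. z ^ i) \<in> M"
    using zp_cong_1 by (simp add: power_diff_1_eq)
  ultimately have "(\<Sum>i<p. z ^ i) \<in> M"
    using ideal_prime[of "z - 1" "\<Sum>i<p. z ^ i"] z_mem[of 1] by (auto intro: diff_mem one_mem sum_mem z_mem)
  then have "z ^ (p - 1) - (\<Sum>i<p - 1. of_int (- 1) * z ^ i) \<in> M"
    by (subst (asm) p(2)) (simp add: sum_negf add.commute)
  then obtain a :: "nat \<Rightarrow> int" where a: "x - (\<Sum>i<p - 1. of_int (a i) * z ^ i) \<in> M"
    using int_adjoin_reduce[OF ideal p(1) _ assms, of "\<lambda>_. - 1"] by blast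
  \<comment> \<open>\<open>restrict\<close> fixes the values outside the range, so that each digit
    vector is counted once.\<close>
  define b where "b = restrict (\<lambda>i. a i mod int q) {..<p - 1}"
  have "(\<Sum>i<p - 1. of_int (a i) * z ^ i) - (\<Sum>i<p - 1. of_int (b i) * z ^ i) \<in> M"
    by (intro sum_cong mult_cong) (auto simp: b_def of_int_cong_mod of_int_mem z_mem submodule_zero[OF ideal])
  with a have "x - (\<Sum>i<p - 1. of_int (b i) * z ^ i) \<in> M"
    using submodule_add[OF ideal] by fastforce
  moreover have "b \<in> {..<p - 1} \<rightarrow>\<^sub>E {0..<int q}"
    using prime_gt_0_nat[OF prime_q] by (auto simp: b_def)
  ultimately show ?thesis by blast
qed

text \<open>The powers \<open>z ^ (q ^ l)\<close> for \<open>l < p - 1\<close> are distinct roots in the residue field of every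
  polynomial over the prime field that has the root \<open>z\<close>.\<close>

lemma residue_independent:
  fixes c :: "nat \<Rightarrow> int"
  assumes ord: "\<And>k. 0 < k \<Longrightarrow> k < p - 1 \<Longrightarrow> \<not> [q ^ k = 1] (mod p)"
    and c: "(\<Sum>i<p - 1. of_int (c i) * z ^ i) \<in> M" and i: "i < p - 1"
  shows "int q dvd c i"
proof -
  define f :: "complex poly" where "f = (\<Sum>i<p - 1. monom (of_int (c i)) i)"
  have coeff_f: "coeff f j = (if j < p - 1 then of_int (c j) else 0)" for j
    by (simp add: f_def coeff_sum)
  have poly_f: "poly f x = (\<Sum>i<p - 1. of_int (c i) * x ^ i)" for x
    by (simp add: f_def poly_sum poly_monom)
  have roots: "poly f (z ^ (q ^ l)) \<in> M" for l
  proof (induction l)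
    case 0
    then show ?case using c by (simp add: poly_f)
  next
    case (Suc l)
    have "poly f (z ^ (q ^ l)) ^ q \<in> M"
      using submodule_scale'[OF ideal Suc, of "poly f (z ^ (q ^ l)) ^ (q - 1)"] prime_gt_0_nat[OF prime_q]
      by (cases q) (auto simp: poly_f intro!: power_mem sum_mem mult_mem of_int_mem z_mem)
    moreover have "poly f (z ^ (q ^ l)) ^ q - poly f ((z ^ (q ^ l)) ^ q) \<in> M"
      unfolding poly_f by (rule frobenius_poly[OF z_mem])
    ultimately have "poly f ((z ^ (q ^ l)) ^ q) \<in> M"
      using submodule_diff_iff[OF ideal] by blast
    then show ?case by (simp add: mult.commute flip: power_mult)
  qed
  have "coeff f i \<in> M"
  proof (rule coeffs_in_ideal_if_roots[where n = "p - 1" and x = "\<lambda>l. z ^ (q ^ l)"])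
    show "degree f < p - 1"
      using i coeff_f by (intro degree_lessI) auto
  next
    fix l m assume lm: "l < m" "m < p - 1"
    have "q > 1" using prime_gt_1_nat[OF prime_q] .
    \<comment> \<open>\<open>p\<close> divides neither factor of this difference of exponents; for
      the second factor this is the hypothesis \<open>ord\<close>.\<close>
    have split: "q ^ m - q ^ l = q ^ l * (q ^ (m - l) - 1)"
      using lm by (simp add: right_diff_distrib' flip: power_add)
    have "\<not> p dvd q ^ l"
      using prime_p prime_q neq prime_dvd_power primes_dvd_imp_eq by blast
    moreover have "\<not> p dvd q ^ (m - l) - 1"
      using ord[of "m - l"] lm \<open>q > 1\<close> by (auto simp: cong_altdef_nat)
    ultimately have "z ^ (q ^ m) - z ^ (q ^ l) \<notin> M"
      using z_power_cong_iff[of "q ^ l" "q ^ m"] lm \<open>q > 1\<close> prime_p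
      by (auto simp: split prime_dvd_mult_iff)
    then show "z ^ (q ^ l) - z ^ (q ^ m) \<notin> M"
      using submodule_uminus[OF ideal, of "z ^ (q ^ l) - z ^ (q ^ m)"] by auto
  qed (use roots in \<open>auto simp: coeff_f of_int_mem zero_mem z_mem\<close>)
  then show ?thesis using i by (simp add: coeff_f of_int_mem_iff)
qed

end

lemma (in subring_ideal) nakayama_set:
  assumes S: "finite S" and w: "\<And>s. s \<in> S \<Longrightarrow> w s \<in> comb_set M S w" and nz: "s0 \<in> S" "w s0 \<noteq> 0"
  shows "1 \<in> M"
proof -
  obtain f where f: "bij_betw f {0..<card S} S" using ex_bij_betw_nat_finite[OF S] by blast
  then have f: "bij_betw f {..<card S} S" by (simp add: atLeast0LessThan)
  obtain i0 where i0: "i0 < card S" "f i0 = s0" using f nz(1) by (force simp: bij_betw_def)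
  show ?thesis
  proof (rule nakayama[where v = "w \<circ> f"])
    fix i assume "i < card S"
    then have "w (f i) \<in> comb_set M S w" using f w by (auto simp: bij_betw_def)
    then obtain c where c: "\<forall>s\<in>S. c s \<in> M" "w (f i) = (\<Sum>s\<in>S. c s * w s)" by (auto simp: comb_set_def)
    then have "w (f i) = (\<Sum>t<card S. c (f t) * w (f t))"
      using sum.reindex_bij_betw[OF f, of "\<lambda>s. c s * w s"] by simp
    then show "(w \<circ> f) i \<in> comb_set M {..<card S} (w \<circ> f)"
      unfolding comb_set_def using c f by (intro CollectI exI[of _ "c \<circ> f"]) (auto simp: bij_betw_def)
  qed (use i0 nz in auto)
qed

section \<open>The residue field as a ring record\<close>

definition subring_record :: "'a::comm_ring_1 set \<Rightarrow> 'a ring" where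
  "subring_record R = \<lparr>carrier = R, monoid.mult = (*), one = 1, zero = 0, add = (+)\<rparr>"

lemma subring_record_simps [simp]:
  "carrier (subring_record R) = R" "monoid.mult (subring_record R) = (*)" "one (subring_record R) = 1"
  "zero (subring_record R) = 0" "add (subring_record R) = (+)"
  by (simp_all add: subring_record_def)

lemma (in subring_set) cring_subring_record: "cring (subring_record R)"
proof (rule cringI)
  show "abelian_group (subring_record R)"
  proof (rule abelian_groupI)
    fix x assume "x \<in> carrier (subring_record R)"
    then show "\<exists>y\<in>carrier (subring_record R). y \<oplus>\<^bsub>subring_record R\<^esub> x = \<zero>\<^bsub>subring_record R\<^esub>"
      by (auto intro!: bexI[of _ "- x"] uminus_mem)
  qed (auto simp: add_mem zero_mem)
  show "Group.comm_monoid (subring_record R)"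
    by (rule comm_monoidI) (auto simp: mult_mem one_mem)
qed (auto simp: distrib_right)

lemma (in subring_set) subring_record_minus:
  assumes "x \<in> R" "y \<in> R"
  shows "x \<ominus>\<^bsub>subring_record R\<^esub> y = x - y"
proof -
  interpret C: cring "subring_record R" by (rule cring_subring_record)
  have "\<ominus>\<^bsub>subring_record R\<^esub> y = - y"
    using assms by (intro C.minus_equality) (auto intro: uminus_mem)
  then show ?thesis by (simp add: a_minus_def)
qed

lemma (in subring_ideal) ideal_subring_record:
  assumes "submodule J" "J \<subseteq> R"
  shows "Ideal.ideal J (subring_record R)"
proof -
  interpret C: cring "subring_record R" by (rule cring_subring_record)
  show ?thesis
  proof (rule idealI)
    show "subgroup J (add_monoid (subring_record R))"
    proof (rule C.add.subgroupI)
      fix x assume x: "x \<in> J"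
      have "\<ominus>\<^bsub>subring_record R\<^esub> x = - x"
        using assms x by (intro C.minus_equality) (auto intro: uminus_mem)
      then show "\<ominus>\<^bsub>subring_record R\<^esub> x \<in> J" using x by (simp add: submodule_uminus[OF assms(1)])
    qed (use assms submodule_zero[OF assms(1)] in \<open>auto intro: submodule_add\<close>)
  qed (use assms C.ring_axioms in \<open>auto intro: submodule_scale submodule_scale'\<close>)
qed

text \<open>An ideal strictly above \<open>M\<close> contains some \<open>d\<close> that is
  invertible modulo \<open>M\<close>, and therefore contains 1.\<close>

lemma (in subring_maximal_ideal) maximalideal_subring_record: "maximalideal M (subring_record R)"
proof (rule maximalidealI)
  show "Ideal.ideal M (subring_record R)" by (rule ideal_subring_record[OF ideal ideal_subset])
  show "carrier (subring_record R) \<noteq> M" using proper one_mem by auto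
next
  fix J assume J: "Ideal.ideal J (subring_record R)" "M \<subseteq> J" "J \<subseteq> carrier (subring_record R)"
  interpret J: Ideal.ideal J "subring_record R" by fact
  show "J = M \<or> J = carrier (subring_record R)"
  proof (rule disjCI)
    assume "J \<noteq> carrier (subring_record R)"
    then have "1 \<notin> J" using J.one_imp_carrier by auto
    show "J = M"
    proof (rule ccontr)
      assume "J \<noteq> M"
      then obtain d where d: "d \<in> J" "d \<notin> M" using J by blast
      then obtain e where e: "e \<in> R" "e * d - 1 \<in> M" using inverse_mod[of d] J by auto
      then have "e * d \<in> J" using J.I_l_closed[of d e] d by simp
      moreover have "- (e * d - 1) \<in> J" using e submodule_uminus[OF ideal] J(2) by blast
      ultimately have "e * d \<oplus>\<^bsub>subring_record R\<^esub> - (e * d - 1) \<in> J" by (rule additive_subgroup.a_closed[OF J.is_additive_subgroup])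
      with \<open>1 \<notin> J\<close> show False by simp
    qed
  qed
qed

text \<open>\<open>h\<close> labels the cosets of \<open>M\<close>, so the image ring is the
  quotient field carried over to the type of the labels. Field records of this kind are what
  \<open>minors_bound\<close> is stated for.\<close>

lemma (in subring_maximal_ideal) residue_field:
  assumes h: "\<And>x y. x \<in> R \<Longrightarrow> y \<in> R \<Longrightarrow> h x = h y \<longleftrightarrow> x - y \<in> M"
  shows "field (image_ring h (subring_record R))"
    and "h \<in> Ring.ring_hom (subring_record R) (image_ring h (subring_record R))"
proof -
  interpret C: cring "subring_record R" by (rule cring_subring_record)
  have weak: "weak_ring_morphism h M (subring_record R)"
    using h by (intro weak_ring_morphismI ideal_subring_record ideal ideal_subset)
      (auto simp: subring_record_minus)
  show "field (image_ring h (subring_record R))"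
    by (rule C.image_ring_is_field[OF weak maximalideal.quotient_is_field[OF maximalideal_subring_record C.is_cring]])
  show "h \<in> Ring.ring_hom (subring_record R) (image_ring h (subring_record R))"
    by (rule C.weak_ring_morphism_is_hom[OF weak])
qed

context subring_set
begin

context
  fixes h :: "'a \<Rightarrow> 'b" and K :: "('b, 'c) ring_scheme"
  assumes K: "cring K" and h: "h \<in> Ring.ring_hom (subring_record R) K"
begin

interpretation C: cring "subring_record R" by (rule cring_subring_record)
interpretation K: cring K by (rule K)
interpretation H: ring_hom_cring "subring_record R" K h
  by (intro ring_hom_cring.intro ring_hom_cring_axioms.intro C.is_cring K h)

lemma hom_power: "x \<in> R \<Longrightarrow> h (x ^ n) = h x [^]\<^bsub>K\<^esub> n"
  using H.hom_mult[of "x ^ _" x] H.hom_one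
  by (induction n) (auto simp: power_mem mult.commute)

lemma hom_sum: "(\<And>i. i \<in> S \<Longrightarrow> f i \<in> R) \<Longrightarrow> h (sum f S) = (\<Oplus>\<^bsub>K\<^esub>i\<in>S. h (f i))"
proof (induction S rule: infinite_finite_induct)
  case (insert x F)
  then have "h (f x + sum f F) = h (f x) \<oplus>\<^bsub>K\<^esub> h (sum f F)"
    using H.hom_add[of "f x" "sum f F"] by (simp add: sum_mem)
  with insert show ?case
    using H.hom_closed by (subst K.finsum_insert) auto
qed (use H.hom_zero in auto)

lemma hom_prod: "(\<And>i. i \<in> S \<Longrightarrow> f i \<in> R) \<Longrightarrow> h (prod f S) = (\<Otimes>\<^bsub>K\<^esub>i\<in>S. h (f i))"
proof (induction S rule: infinite_finite_induct)
  case (insert x F)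
  then have "h (f x * prod f F) = h (f x) \<otimes>\<^bsub>K\<^esub> h (prod f F)"
    using H.hom_mult[of "f x" "prod f F"] by (simp add: prod_mem)
  with insert show ?case
    using H.hom_closed by (subst K.finprod_insert) auto
qed (use H.hom_one in auto)

lemma hom_uminus: "x \<in> R \<Longrightarrow> h (- x) = \<ominus>\<^bsub>K\<^esub> h x"
  using H.hom_add[of "- x" x] H.hom_zero H.hom_closed
  by (intro K.minus_equality[symmetric]) (auto simp: uminus_mem)

text \<open>The link between the two notions of determinant: a homomorphism commutes with every term
  of the Leibniz formula.\<close>

lemma hom_det:
  assumes A: "A \<in> carrier_mat n n" "\<And>i j. i < n \<Longrightarrow> j < n \<Longrightarrow> A $$ (i, j) \<in> R"
    and B: "B \<in> carrier_mat n n" "\<And>i j. i < n \<Longrightarrow> j < n \<Longrightarrow> B $$ (i, j) = h (A $$ (i, j))"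
  shows "ring_det K B = h (det A)"
proof -
  let ?P = "{\<sigma>. \<sigma> permutes {0..<n}}"
  have lt: "\<sigma> i < n" if "\<sigma> \<in> ?P" "i < n" for \<sigma> i
    using that by (auto dest: permutes_in_image)
  have prod_R: "(\<Prod>i = 0..<n. A $$ (i, \<sigma> i)) \<in> R" if "\<sigma> \<in> ?P" for \<sigma>
    using that lt A by (intro prod_mem) auto
  have summand: "(let t = (\<Otimes>\<^bsub>K\<^esub>i\<in>{0..<n}. B $$ (i, \<sigma> i)) in if evenperm \<sigma> then t else \<ominus>\<^bsub>K\<^esub> t) =
      h (signof \<sigma> * (\<Prod>i = 0..<n. A $$ (i, \<sigma> i)))" if \<sigma>: "\<sigma> \<in> ?P" for \<sigma>
  proof -
    have "(\<Otimes>\<^bsub>K\<^esub>i\<in>{0..<n}. B $$ (i, \<sigma> i)) = (\<Otimes>\<^bsub>K\<^esub>i\<in>{0..<n}. h (A $$ (i, \<sigma> i)))"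
      using lt[OF \<sigma>] A B H.hom_closed by (intro K.finprod_cong') auto
    also have "\<dots> = h (\<Prod>i = 0..<n. A $$ (i, \<sigma> i))"
      using lt[OF \<sigma>] A by (intro hom_prod[symmetric]) auto
    finally show ?thesis
      using hom_uminus[OF prod_R[OF \<sigma>]] by (simp add: Let_def sign_def)
  qed
  have summand_R: "signof \<sigma> * (\<Prod>i = 0..<n. A $$ (i, \<sigma> i)) \<in> R" if "\<sigma> \<in> ?P" for \<sigma>
    by (rule mult_mem[OF signof_mem prod_R[OF that]])
  have "ring_det K B = (\<Oplus>\<^bsub>K\<^esub>\<sigma>\<in>?P.
      let t = (\<Otimes>\<^bsub>K\<^esub>i\<in>{0..<n}. B $$ (i, \<sigma> i)) in if evenperm \<sigma> then t else \<ominus>\<^bsub>K\<^esub> t)"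
    using B(1) unfolding ring_det_def carrier_mat_def by simp
  also have "\<dots> = (\<Oplus>\<^bsub>K\<^esub>\<sigma>\<in>?P. h (signof \<sigma> * (\<Prod>i = 0..<n. A $$ (i, \<sigma> i))))"
    by (rule K.finsum_cong'[OF refl _ summand]) (use summand_R H.hom_closed in auto)
  also have "\<dots> = h (det A)"
    unfolding det_def'[OF A(1)] by (rule hom_sum[OF summand_R, symmetric])
  finally show ?thesis .
qed

end

end

text \<open>The order of a generator is the order of the group of units, which is
  \<open>p - 1\<close>.\<close>

lemma generates_units_mod_order:
  assumes p: "prime p" and gen: "generates_units_mod p q" and k: "0 < k" "k < p - 1"
  shows "\<not> [q ^ k = 1] (mod p)"
proof
  assume cong: "[q ^ k = 1] (mod p)"
  define R where "R = residue_ring (int p)"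
  interpret residues_prime p R using p by unfold_locales (simp_all add: R_def)
  interpret G: group "units_of R" by (rule units_group)
  let ?a = "int q mod int p"
  have a: "?a \<in> carrier (units_of R)" and gen: "generate (units_of R) {?a} = carrier (units_of R)"
    using gen by (auto simp: generates_units_mod_def R_def)
  have "G.ord ?a = card (Units R)"
    using G.generate_pow_card[OF a] gen by (simp add: units_of_carrier)
  also have "\<dots> = p - 1" using totient_eq prime_totient_eq by simp
  finally have ord: "G.ord ?a = p - 1" .
  have "?a [^]\<^bsub>units_of R\<^esub> k = ?a [^]\<^bsub>R\<^esub> k"
    using a by (simp add: units_of_pow units_of_carrier)
  also have "\<dots> = int q ^ k mod int p" by (rule pow_cong)
  also have "\<dots> = 1 mod int p" using cong by (metis cong_def cong_int_iff of_nat_1 of_nat_power)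
  also have "\<dots> = \<one>\<^bsub>units_of R\<^esub>" by (simp add: units_of_one one_cong)
  finally have "p - 1 dvd k" using G.pow_eq_id[OF a] ord by simp
  then show False using k by (auto dest: dvd_imp_le)
qed

section \<open>Fourier minors and kernel vectors modulo \<open>M\<close>\<close>

context cyclotomic_residue
begin

text \<open>The values are natural numbers because \<^const>\<open>minors_bound\<close> only ranges over fields of such.\<close>

lemma ex_residue_map:
  assumes ord: "\<And>k. 0 < k \<Longrightarrow> k < p - 1 \<Longrightarrow> \<not> [q ^ k = 1] (mod p)"
  obtains h :: "complex \<Rightarrow> nat" where
    "\<And>x y. x \<in> \<O> \<Longrightarrow> y \<in> \<O> \<Longrightarrow> h x = h y \<longleftrightarrow> x - y \<in> M" "card (h ` \<O>) = q ^ (p - 1)"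
proof -
  define coset where "coset x = {y \<in> \<O>. y - x \<in> M}" for x
  have coset_eq: "coset x = coset y \<longleftrightarrow> x - y \<in> M" if "x \<in> \<O>" "y \<in> \<O>" for x y
  proof
    assume eq: "coset x = coset y"
    have "x \<in> coset x" using that submodule_zero[OF ideal] by (simp add: coset_def)
    then have "x \<in> coset y" by (simp only: eq)
    then show "x - y \<in> M" by (simp add: coset_def)
  next
    assume xy: "x - y \<in> M"
    have "u - x \<in> M \<longleftrightarrow> u - y \<in> M" for u
      using submodule_diff_iff[OF ideal, of "u - y" "u - x"] xy by simp
    then show "coset x = coset y" by (simp add: coset_def)
  qed
  \<comment> \<open>Digit vectors parametrise the residue classes: by
    \<open>residue_representative\<close> all classes are reached, by
    \<open>residue_independent\<close> none is reached twice.\<close>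
  define D where "D = {..<p - 1} \<rightarrow>\<^sub>E {0..<int q}"
  define ev :: "(nat \<Rightarrow> int) \<Rightarrow> complex" where "ev a = (\<Sum>i<p - 1. of_int (a i) * z ^ i)" for a
  have ev_mem: "ev a \<in> \<O>" for a unfolding ev_def by (intro sum_mem mult_mem of_int_mem z_mem)
  have "coset ` \<O> = (\<lambda>a. coset (ev a)) ` D"
  proof (intro Set.set_eqI iffI)
    fix X assume "X \<in> coset ` \<O>"
    then obtain x where x: "x \<in> \<O>" "X = coset x" by blast
    then obtain a where "a \<in> D" "x - ev a \<in> M"
      using residue_representative[of x] by (auto simp: D_def ev_def)
    then show "X \<in> (\<lambda>a. coset (ev a)) ` D" using coset_eq[OF x(1) ev_mem] x by blast
  qed (use ev_mem in auto)
  moreover have "inj_on (\<lambda>a. coset (ev a)) D"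
  proof (rule inj_onI)
    fix a b assume ab: "a \<in> D" "b \<in> D" "coset (ev a) = coset (ev b)"
    then have "ev a - ev b \<in> M" using coset_eq[OF ev_mem ev_mem] by blast
    then have diff: "(\<Sum>i<p - 1. of_int (a i - b i) * z ^ i) \<in> M"
      unfolding ev_def sum_subtractf[symmetric] left_diff_distrib[symmetric] of_int_diff[symmetric] .
    have "a i = b i" if "i < p - 1" for i
    proof -
      have "int q dvd a i - b i" by (rule residue_independent[OF ord diff that])
      moreover have "a i \<in> {0..<int q}" "b i \<in> {0..<int q}" using PiE_mem[OF ab(1)[unfolded D_def]] PiE_mem[OF ab(2)[unfolded D_def]] that by blast+
      ultimately show ?thesis using mod_eq_dvd_iff[of "a i" "int q" "b i"] by simp
    qed
    then show "a = b" using ab(1,2) unfolding D_def by (intro PiE_ext) auto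
  qed
  moreover have "card D = q ^ (p - 1)" and "finite D" by (simp_all add: D_def card_funcsetE finite_PiE)
  ultimately have card: "card (coset ` \<O>) = q ^ (p - 1)" and "finite (coset ` \<O>)"
    by (simp_all add: card_image)
  then obtain e :: "complex set \<Rightarrow> nat" where e: "inj_on e (coset ` \<O>)"
    using finite_imp_inj_to_nat_seg by blast
  show thesis
  proof (rule that[of "e \<circ> coset"])
    fix x y assume "x \<in> \<O>" "y \<in> \<O>"
    then show "(e \<circ> coset) x = (e \<circ> coset) y \<longleftrightarrow> x - y \<in> M"
      using e coset_eq by (auto simp: inj_on_eq_iff)
  next
    show "card ((e \<circ> coset) ` \<O>) = q ^ (p - 1)"
      using card card_image[OF e] by (simp add: image_comp)
  qed
qed

text \<open>The residue field has \<open>q ^ (p - 1)\<close> elements and \<open>z ^ q\<close>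
  reduces to a primitive \<open>p\<close>-th root of unity, so \<open>minors_bound\<close> applies
  with \<open>r = q\<close>. The reduction map sends the determinant to a minor over that
  field.\<close>

lemma fourier_minor_not_mem:
  assumes bound: "minors_bound p \<Gamma>" "real q > \<Gamma>" and gen: "generates_units_mod p q"
    and S: "S \<subseteq> {..<p}"
  shows "det (submatrix (mat p p (\<lambda>(j, k). (z ^ q) ^ (j * k))) S S) \<notin> M"
proof
  let ?F = "mat p p (\<lambda>(j, k). (z ^ q) ^ (j * k))"
  assume det: "det (submatrix ?F S S) \<in> M"
  obtain h :: "complex \<Rightarrow> nat" where h: "\<And>x y. x \<in> \<O> \<Longrightarrow> y \<in> \<O> \<Longrightarrow> h x = h y \<longleftrightarrow> x - y \<in> M"
    and card: "card (h ` \<O>) = q ^ (p - 1)"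
    using ex_residue_map[OF generates_units_mod_order[OF prime_p gen]] by blast
  define K where "K = image_ring h (subring_record \<O>)"
  have K: "field K" and hom: "h \<in> Ring.ring_hom (subring_record \<O>) K"
    unfolding K_def using residue_field[OF h] by blast+
  interpret K: field K by (rule K)
  have carrier_K: "carrier K = h ` \<O>" by (simp add: K_def image_ring_carrier)
  have one_K: "\<one>\<^bsub>K\<^esub> = h 1" and zero_K: "\<zero>\<^bsub>K\<^esub> = h 0"
    by (simp_all add: K_def image_ring_one image_ring_zero)
  note pow = hom_power[OF K.is_cring hom]
  have h_pow: "h (z ^ q) [^]\<^bsub>K\<^esub> k = h ((z ^ q) ^ k)" for k by (rule pow[OF z_mem, symmetric])
  have "primitive_root_of_unity K p (h (z ^ q))"
    unfolding primitive_root_of_unity_def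
  proof (intro conjI allI impI)
    show "h (z ^ q) \<in> carrier K" by (auto simp: carrier_K z_mem)
    show "h (z ^ q) [^]\<^bsub>K\<^esub> p = \<one>\<^bsub>K\<^esub>"
      using root by (simp add: h_pow one_K mult.commute flip: power_mult)
  next
    fix k :: nat assume k: "0 < k \<and> k < p"
    have "\<not> p dvd q * k"
      using k prime_p prime_q neq primes_dvd_imp_eq by (auto simp: prime_dvd_mult_iff dest: dvd_imp_le)
    then show "h (z ^ q) [^]\<^bsub>K\<^esub> k \<noteq> \<one>\<^bsub>K\<^esub>"
      using z_power_cong_1_iff[of "q * k"] h[OF z_mem one_mem, of "q * k"]
      by (simp add: h_pow one_K power_mult)
  qed
  then have "all_minors_nonzero K (mat p p (\<lambda>(j, k). h (z ^ q) [^]\<^bsub>K\<^esub> (j * k)))"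
    using bound K card prime_q odd_q gen by (auto simp: minors_bound_def carrier_K)
  then have nz: "ring_det K (submatrix (mat p p (\<lambda>(j, k). h (z ^ q) [^]\<^bsub>K\<^esub> (j * k))) S S) \<noteq> \<zero>\<^bsub>K\<^esub>"
    using S by (auto simp: all_minors_nonzero_def)
  have S_eq: "{i. i < p \<and> i \<in> S} = S" using S by auto
  have pick: "pick S i < p" if "i < card S" for i
    using pick_in_set_le[OF that] S by auto
  have F_mem: "submatrix ?F S S $$ (i, j) \<in> \<O>" if "i < card S" "j < card S" for i j
    using that pick by (simp add: submatrix_def S_eq power_mem z_mem)
  have "ring_det K (submatrix (mat p p (\<lambda>(j, k). h (z ^ q) [^]\<^bsub>K\<^esub> (j * k))) S S) = h (det (submatrix ?F S S))"
    by (rule hom_det[OF K.is_cring hom, where n = "card S"])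
       (use F_mem pick in \<open>auto simp: submatrix_def S_eq h_pow\<close>)
  also have "\<dots> = \<zero>\<^bsub>K\<^esub>"
    unfolding zero_K using det det_mem[OF _ F_mem, of "card S"] h[of "det (submatrix ?F S S)" 0]
    by (simp add: zero_mem submatrix_def S_eq)
  finally show False using nz by simp
qed

text \<open>The index \<open>s\<close> encodes the pair \<open>(s div q, s mod q)\<close>. Divided
  differences over the rows of a block yield the moment relations for \<open>moments_vanish\<close>,
  which puts all of \<open>w\<close> into \<open>M\<close> times its span; Nakayama's lemma excludes
  a nonzero entry.\<close>

lemma kronecker_kernel_trivial:
  fixes w :: "nat \<Rightarrow> complex"
  assumes I: "I \<subseteq> {..<p * q}" and inj: "inj_on (\<lambda>b. (z ^ p) ^ b) {..<q}"
    and minors: "\<And>S. S \<subseteq> {..<p} \<Longrightarrow> det (submatrix (mat p p (\<lambda>(j, k). (z ^ q) ^ (j * k))) S S) \<notin> M"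
    and eq: "\<And>r. r \<in> I \<Longrightarrow> (\<Sum>s\<in>I. (z ^ q) ^ ((r div q) * (s div q)) * (z ^ p) ^ ((r mod q) * (s mod q)) * w s) = 0"
    and s0: "s0 \<in> I"
  shows "w s0 = 0"
proof (rule ccontr)
  assume nz: "w s0 \<noteq> 0"
  have fin: "finite I" using I finite_subset by blast
  have q: "q > 0" using prime_gt_0_nat[OF prime_q] .
  let ?W = "comb_set \<O> I w" and ?N = "comb_set M I w"
  interpret residue_module \<O> M ?W ?N
  proof
    show "submodule ?W" "submodule ?N"
      by (simp_all add: submodule_comb_set submodule_self ideal)
    fix m x assume m: "m \<in> M" and "x \<in> ?W"
    then obtain c where "\<forall>s\<in>I. c s \<in> \<O>" "x = (\<Sum>s\<in>I. c s * w s)" by (auto simp: comb_set_def)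
    then show "m * x \<in> ?N"
      unfolding comb_set_def using m
      by (intro CollectI exI[of _ "\<lambda>s. m * c s"]) (auto simp: sum_distrib_left mult.assoc submodule_scale'[OF ideal])
  qed
  have w_W: "s \<in> I \<Longrightarrow> w s \<in> ?W" for s
    by (rule comb_set_generator[OF fin]) (simp_all add: one_mem zero_mem)
  \<comment> \<open>The positions of \<open>I\<close> in block \<open>a\<close>. As \<open>I\<close>
    indexes both rows and columns, each block has as many equations as unknowns.\<close>
  define Ix where "Ix a = {b. b < q \<and> a * q + b \<in> I}" for a
  have Ix_sub: "Ix a \<subseteq> {..<q}" for a by (auto simp: Ix_def)
  have Ix_fin: "finite (Ix a)" for a using Ix_sub finite_subset by blast
  have sum_blocks: "(\<Sum>s\<in>I. f s) = (\<Sum>a<p. \<Sum>b\<in>Ix a. f (a * q + b))" for f :: "nat \<Rightarrow> complex"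
  proof -
    have "(\<Sum>a<p. \<Sum>b\<in>Ix a. f (a * q + b)) = (\<Sum>(a, b)\<in>(SIGMA a:{..<p}. Ix a). f (a * q + b))"
      using Ix_fin by (intro sum.Sigma) auto
    also have "\<dots> = (\<Sum>s\<in>I. f s)"
    proof (rule sum.reindex_bij_witness[where j = "\<lambda>(a, b). a * q + b" and i = "\<lambda>s. (s div q, s mod q)"])
      fix s assume "s \<in> I"
      then show "(s div q, s mod q) \<in> (SIGMA a:{..<p}. Ix a)"
        using I q by (auto simp: Ix_def less_mult_imp_div_less)
    qed (auto simp: Ix_def q)
    finally show ?thesis by simp
  qed
  have moments: "(\<Sum>a'<p. (z ^ q) ^ (a * a') * (\<Sum>b\<in>Ix a'. of_nat (b choose k) * w (a' * q + b))) \<in> ?N"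
    if a: "a < p" and k: "k < card (Ix a)" for a k
  proof -
    \<comment> \<open>A divided difference of order \<open>k\<close> takes \<open>k + 1\<close>
      nodes, hence \<open>Suc k\<close> rows of the block; \<open>k < card (Ix a)\<close> provides
      them.\<close>
    define bs where "bs = take (Suc k) (sorted_list_of_set (Ix a))"
    \<comment> \<open>These nodes are distinct complex numbers but all congruent to 1 modulo
      \<open>M\<close>, so the divided differences are formed before the reduction.\<close>
    define xs where "xs = map (\<lambda>b. (z ^ p) ^ b) bs"
    have bs: "distinct bs" "set bs \<subseteq> Ix a" "length bs = Suc k"
      using k Ix_fin[of a] set_take_subset[of "Suc k" "sorted_list_of_set (Ix a)"] by (auto simp: bs_def)
    have xs_R: "set xs \<subseteq> \<O>" by (auto simp: xs_def power_mem z_mem)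
    have xs_1: "x - 1 \<in> M" if x: "x \<in> set xs" for x
    proof -
      obtain b where "x = (z ^ p) ^ b" using x by (auto simp: xs_def)
      then show ?thesis using power_cong[OF z_mem one_mem zp_cong_1, of b] by simp
    qed
    let ?c = "\<lambda>s. (z ^ q) ^ (a * (s div q)) * w s"
    have "(\<Sum>s\<in>I. ?c s * divdiff xs (s mod q)) = 0"
    proof (rule sum_divdiff_eq_0)
      show "xs \<noteq> []" using bs by (auto simp: xs_def)
      show "distinct xs"
        unfolding xs_def using bs Ix_sub[of a] inj by (auto simp: distinct_map intro: inj_on_subset)
    next
      fix x assume "x \<in> set xs"
      then obtain b where b: "b \<in> Ix a" "x = (z ^ p) ^ b" using bs by (auto simp: xs_def)
      then have "a * q + b \<in> I" "b < q" by (auto simp: Ix_def)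
      then have "(\<Sum>s\<in>I. (z ^ q) ^ (a * (s div q)) * (z ^ p) ^ (b * (s mod q)) * w s) = 0"
        using eq[of "a * q + b"] by simp
      then show "(\<Sum>s\<in>I. ?c s * x ^ (s mod q)) = 0"
        by (simp add: b(2) power_mult[of "z ^ p"] mult_ac)
    qed
    \<comment> \<open>By \<open>divdiff_cong\<close>, the passage to binomial coefficients costs
      only multiples of the \<open>w s\<close> by elements of \<open>M\<close>.\<close>
    moreover have "(\<Sum>s\<in>I. (z ^ q) ^ (a * (s div q)) * ((divdiff xs (s mod q) - of_nat ((s mod q) choose k)) * w s)) \<in> ?N"
      using bs(3)
      by (intro submodule_sum[OF N] submodule_scale[OF N] ideal_times divdiff_cong xs_R xs_1 w_W power_mem z_mem)
         (simp_all add: xs_def)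
    ultimately have "(\<Sum>s\<in>I. (z ^ q) ^ (a * (s div q)) * (of_nat ((s mod q) choose k) * w s)) \<in> ?N"
      using submodule_uminus[OF N] by (fastforce simp: algebra_simps sum_subtractf)
    then show ?thesis
      unfolding sum_blocks sum_distrib_left by (simp add: Ix_def cong: sum.cong_simp)
  qed
  have "w (a * q + b) \<in> ?N" if "a < p" "b \<in> Ix a" for a b
  proof (rule moments_vanish[where p = p and I = Ix and z = "z ^ q" and w = "\<lambda>a b. w (a * q + b)"])
    fix a b c assume "b \<in> Ix a" "c \<in> Ix a" "b \<noteq> c"
    then have bc: "b < q" "c < q" "b \<noteq> c" using Ix_sub by auto
    show "of_nat b - of_nat c \<notin> M"
    proof
      assume "of_nat b - of_nat c \<in> M"
      then have "int q dvd int b - int c" using of_int_mem_iff[of "int b - int c"] by simp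
      then show False using bc by (metis mod_eq_dvd_iff mod_less of_nat_eq_iff of_nat_mod)
    qed
  qed (use that minors moments Ix_fin w_W z_mem in \<open>auto simp: Ix_def\<close>)
  then have w_N: "w (a * q + b) \<in> ?N" if "a < p" "b \<in> Ix a" for a b using that by blast
  have "w s \<in> ?N" if "s \<in> I" for s
  proof -
    have "s div q < p" "s mod q \<in> Ix (s div q)"
      using that I q less_mult_imp_div_less[of s p q] by (auto simp: Ix_def)
    then show ?thesis using w_N[of "s div q" "s mod q"] by simp
  qed
  then show False using nakayama_set[of I w s0] fin s0 nz proper by blast
qed

end

section \<open>Complex roots of unity and the conclusion\<close>

lemma exp_root_of_unity_power: "exp (2 * of_real pi * \<i> / of_nat n) ^ k = cis (2 * pi * real k / real n)"
  by (simp add: cis_conv_exp flip: exp_of_nat_mult) (simp add: field_simps)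

lemma exp_root_of_unity_power_self: "n > 0 \<Longrightarrow> exp (2 * of_real pi * \<i> / of_nat n) ^ n = 1"
  by (simp add: exp_root_of_unity_power)

lemma inj_on_exp_root_of_unity_power:
  "n > 0 \<Longrightarrow> inj_on (\<lambda>k. exp (2 * of_real pi * \<i> / of_nat n) ^ k) {..<n}"
  using bij_betw_roots_unity[of n] by (simp add: exp_root_of_unity_power bij_betw_def)

lemma exp_root_of_unity_mult:
  "n > 0 \<Longrightarrow> exp (2 * of_real pi * \<i> / of_nat (m * n)) ^ n = exp (2 * of_real pi * \<i> / of_nat m)"
  by (simp flip: exp_of_nat_mult)

theorem corollary1:
  fixes p q :: nat and \<Gamma> :: real
  assumes "prime p" and "odd p" and "prime q" and "odd q" and "p \<noteq> q"
    and "minors_bound p \<Gamma>"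
    and "generates_units_mod p q" and "real q > \<Gamma>"
  shows "principally_nonsingular (kronecker_prod (fourier_mat p) (fourier_mat q))"
proof -
  let ?F = "kronecker_prod (fourier_mat p) (fourier_mat q)"
  have p: "p > 1" and q: "q > 1" using assms prime_gt_1_nat by blast+
  \<comment> \<open>One element generates the entries of both Fourier matrices: \<open>z ^ q\<close>
    belongs to \<open>fourier_mat p\<close> and \<open>z ^ p\<close> to
    \<open>fourier_mat q\<close>.\<close>
  define z where "z = exp (2 * of_real pi * \<i> / of_nat (p * q))"
  have zp: "z ^ p = exp (2 * of_real pi * \<i> / of_nat q)"
    using exp_root_of_unity_mult[of p q] p by (simp add: z_def mult.commute)
  have zq: "z ^ q = exp (2 * of_real pi * \<i> / of_nat p)"
    using exp_root_of_unity_mult[of q p] q by (simp add: z_def)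
  have root: "z ^ (p * q) = 1"
    unfolding z_def using p q by (intro exp_root_of_unity_power_self) simp
  have root_neq: "z ^ q \<noteq> 1"
    using inj_onD[OF inj_on_exp_root_of_unity_power[of p], of 1 0] p by (auto simp: zq)
  have inj: "inj_on (\<lambda>b. (z ^ p) ^ b) {..<q}"
    unfolding zp using q by (intro inj_on_exp_root_of_unity_power) simp
  have ideal: "subring_ideal (int_adjoin z) ((*) (of_nat q) ` int_adjoin z)"
    using int_adjoin.mult_mem[OF int_adjoin.of_nat_mem]
    by unfold_locales (auto simp: int_adjoin.submodule_principal)
  have "1 \<notin> (*) (of_nat q) ` int_adjoin z"
    by (rule int_adjoin_root_of_unity_proper[OF q root]) (use p q in simp)
  \<comment> \<open>Any maximal ideal above \<open>q\<close> serves; one exists since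
    \<open>q\<close> is not a unit in \<open>\<int>[z]\<close>.\<close>
  then obtain M where M: "(*) (of_nat q) ` int_adjoin z \<subseteq> M" "subring_maximal_ideal (int_adjoin z) M"
    using subring_ideal.ex_maximal_ideal[OF ideal] by blast
  interpret subring_maximal_ideal "int_adjoin z" M by (rule M(2))
  have "of_nat q \<in> M"
    using M(1) imageI[OF int_adjoin.one_mem[of z], of "(*) (of_nat q)"] by auto
  then interpret cyclotomic_residue z M p q
    using assms root root_neq by unfold_locales auto
  have dim: "dim_row ?F = p * q" "dim_col ?F = p * q"
    by (simp_all add: kronecker_prod_def fourier_mat_def)
  have F: "?F $$ (r, s) = (z ^ q) ^ ((r div q) * (s div q)) * (z ^ p) ^ ((r mod q) * (s mod q))"
    if "r < p * q" "s < p * q" for r s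
    using that q by (simp add: kronecker_prod_def fourier_mat_def zp zq less_mult_imp_div_less)
  have "det (submatrix ?F I I) \<noteq> 0" if I: "I \<subseteq> {..<p * q}" for I
  proof
    let ?A = "submatrix ?F I I"
    assume "det ?A = 0"
    have fin: "finite I" using I finite_subset by blast
    have I_eq: "{i. i < p * q \<and> i \<in> I} = I" using I by auto
    have A: "?A \<in> carrier_mat (card I) (card I)"
      by (intro carrier_matI) (simp_all add: dim_submatrix dim I_eq)
    have pick: "pick I i \<in> I" "pick I i < p * q" if "i < card I" for i
      using pick_in_set_le[OF that] I by auto
    have A_ij: "?A $$ (i, j) = ?F $$ (pick I i, pick I j)" if "i < card I" "j < card I" for i j
      using that by (simp add: submatrix_index dim I_eq)
    obtain v where v: "v \<in> carrier_vec (card I)" "v \<noteq> 0\<^sub>v (card I)" "?A *\<^sub>v v = 0\<^sub>v (card I)"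
      using \<open>det ?A = 0\<close> det_0_iff_vec_prod_zero[OF A] by blast
    \<comment> \<open>The rank of \<open>s\<close> in \<open>I\<close>, inverse to
      \<open>pick I\<close>; it turns the kernel vector \<open>v\<close> of the submatrix into a
      function \<open>w\<close> on \<open>I\<close>.\<close>
    define ix where "ix s = card {a \<in> I. a < s}" for s
    define w where "w s = v $ ix s" for s
    have ix: "ix s < card I" "pick I (ix s) = s" if "s \<in> I" for s
      using that fin by (auto simp: ix_def pick_card_in_set intro!: psubset_card_mono)
    have w_pick: "w (pick I i) = v $ i" if "i < card I" for i
      using card_pick_le[OF that] by (simp add: w_def ix_def)
    have bij: "bij_betw (pick I) {..<card I} I"
      by (rule bij_betwI[where g = ix]) (use ix pick card_pick_le in \<open>auto simp: ix_def\<close>)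
    have eq: "(\<Sum>s\<in>I. (z ^ q) ^ ((r div q) * (s div q)) * (z ^ p) ^ ((r mod q) * (s mod q)) * w s) = 0"
      if r: "r \<in> I" for r
    proof -
      have "(\<Sum>s\<in>I. (z ^ q) ^ ((r div q) * (s div q)) * (z ^ p) ^ ((r mod q) * (s mod q)) * w s) =
          (\<Sum>s\<in>I. ?F $$ (r, s) * w s)"
        using r I by (intro sum.cong) (auto simp: F subset_eq)
      also have "\<dots> = (\<Sum>j<card I. ?F $$ (r, pick I j) * w (pick I j))"
        using sum.reindex_bij_betw[OF bij, of "\<lambda>s. ?F $$ (r, s) * w s"] by simp
      also have "\<dots> = (\<Sum>j<card I. ?A $$ (ix r, j) * v $ j)"
        using A_ij ix[OF r] w_pick by (intro sum.cong) auto
      also have "\<dots> = (?A *\<^sub>v v) $ ix r"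
        using A v(1) ix[OF r] by (simp add: scalar_prod_def atLeast0LessThan)
      also have "\<dots> = 0" using v(3) ix[OF r] by simp
      finally show ?thesis .
    qed
    have "v = 0\<^sub>v (card I)"
    proof (rule eq_vecI)
      fix i assume "i < dim_vec (0\<^sub>v (card I) :: complex vec)"
      then have i: "i < card I" by simp
      have "w (pick I i) = 0"
        by (rule kronecker_kernel_trivial[OF I inj fourier_minor_not_mem eq pick(1)[OF i]])
           (use assms in auto)
      then show "v $ i = 0\<^sub>v (card I) $ i" using i w_pick by simp
    qed (use v in simp)
    then show False using v(2) by simp
  qed
  then show ?thesis by (simp add: principally_nonsingular_def dim)
qed

end
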